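(* Let $\{V_i\}_{i=1}^m$ be an $(m,l,d)$-reconstruction system on the Hilbert space $\mathcal H$, with analysis operator $V$, such that $\operatorname{tr}((V_i^*V_i)^{1/2})\ge \left(\frac{d\cdot l}{m}\right)^{1/2}$ for $1\le i\le m$. Then (1) $\frac{d}{l}\,I_l\prec_w \mathbf P_q(V)$. Hence: (2) for every unitarily invariant norm $\|\cdot\|$ on $M_l(\mathbb C)$ with associated symmetric gauge function $\psi$, $\ d\cdot \eta_\psi(l)\le \|\mathbf P_q(V)\|$; and (3) for every increasing convex function $f:\mathbb R_{\ge 0}\to\mathbb R$ with $f(0)=0$, $\ l\cdot f\!\left(\frac{d}{l}\right)\le \operatorname{tr}(f(\mathbf P_q(V)))$. Moreover, [majorization holds in (1) (i.e. $\frac{d}{l}I_l\prec \mathbf P_q(V)$), or there exists a unitarily invariant norm for which equality holds in (2), or there exists an increasing strictly convex function $f:\mathbb R_{\ge0}\to\mathbb R$ with $f(0)=0$ for which equality holds in (3)] if and only if $\{V_i\}_{i=1}^m$ is a uniformly weighted projective rank-$l$ $(m,l,d)$-protocol.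
   Context: $\mathbb F$ is $\mathbb R$ or $\mathbb C$; $\mathcal H=\mathbb F^d$, $\mathcal K=\mathbb F^l$ with $l<d$. An $(m,l,d)$-reconstruction system is a family $\{V_i\}_{i=1}^m$ of linear operators $V_i:\mathcal H\to\mathcal K$ such that $\sum_{i=1}^m V_i^*V_i$ is invertible. It is an $(m,l,d)$-protocol if $\sum_{i=1}^m V_i^*V_i=I_d$. Its analysis operator is $V:\mathcal H\to\bigoplus_{i=1}^m\mathcal K$, $Vx=\bigoplus_{i=1}^m V_ix$. Its $q$-potential is $\mathbf P_q(V)=\sum_{i,j=1}^m |V_iV_j^*|^2$, a positive semidefinite $l\times l$ matrix, where $|A|^2=A^*A$. A protocol is projective if for each $i$, $V_i^*V_i=w_iP_i$ with $P_i$ an orthogonal projection on $\mathcal H$ and weight $w_i>0$; it is uniformly weighted projective (u.w.p.) if in addition all weights $w_i$ are equal; it is rank-$l$ if $\operatorname{rank}(V_i^* )=l$ for all $i$. For $x,y\in\mathbb R^l$, with $x^\downarrow$ the non-increasing rearrangement of $x$, $x\prec_w y$ (submajorization) means $\sum_{i=1}^k x_i^\downarrow\le\sum_{i=1}^k y_i^\downarrow$ for $1\le k\le l$; $x\prec y$ (majorization) means in addition $\sum_i x_i=\sum_i y_i$. For self-adjoint $l\times l$ matrices, $A\prec_w B$ (resp. $A\prec B$) means $\lambda(A)\prec_w\lambda(B)$ (resp. $\lambda(A)\prec\lambda(B)$), where $\lambda(A)$ is the vector of eigenvalues counted with multiplicity in decreasing order. The symmetric gauge function $\psi:\mathbb R^l\to\mathbb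 R_{\ge0}$ associated with a unitarily invariant norm $\|\cdot\|$ on $M_l$ satisfies $\|A\|=\psi(s(A))$, where $s(A)$ is the vector of singular values of $A$. $\eta_\psi(l)=\frac{\psi(\mathbf e_l)}{l}=\frac{\|I_l\|}{l}$, where $\mathbf e_l=(1,\dots,1)\in\mathbb R^l$. $\operatorname{tr}$ is the unnormalized trace, and $f(A)$ is defined by functional calculus. *)

theory Defs
  imports
    "Jordan_Normal_Form.Schur_Decomposition"
    "Jordan_Normal_Form.DL_Rank"
    "HOL-Analysis.Convex"
begin

text \<open>
  The scalar field is a set \<open>F\<close> of complex numbers, either \<open>\<real>\<close> or \<open>UNIV\<close>.  An operator from
  \<open>F\<close>-space of dimension \<open>c\<close> to \<open>F\<close>-space of dimension \<open>r\<close> is an \<open>r\<close> by \<open>c\<close> complex matrix all of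
  whose entries lie in \<open>F\<close>.  Adjoint, invertibility, rank, eigenvalues and functional calculus of a
  real matrix do not change when it is regarded as a complex matrix, so these notions need no
  mention of \<open>F\<close>.
\<close>

definition mats_over :: "complex set \<Rightarrow> nat \<Rightarrow> nat \<Rightarrow> complex mat set" where
  "mats_over F r c = {A \<in> carrier_mat r c. elements_mat A \<subseteq> F}"

text \<open>Type \<^typ>\<open>complex mat\<close> has no additive zero, so finite sums are formed entrywise.\<close>

definition matrix_sum :: "nat \<Rightarrow> nat \<Rightarrow> 'i set \<Rightarrow> ('i \<Rightarrow> complex mat) \<Rightarrow> complex mat" where
  "matrix_sum r c I A = mat r c (\<lambda>(a, b). \<Sum>i\<in>I. A i $$ (a, b))"

definition mat_trace :: "complex mat \<Rightarrow> complex" where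
  "mat_trace A = (\<Sum>i<dim_row A. A $$ (i, i))"

definition unitary_mat :: "nat \<Rightarrow> complex mat \<Rightarrow> bool" where
  "unitary_mat n U \<longleftrightarrow>
     U \<in> carrier_mat n n \<and> mat_adjoint U * U = 1\<^sub>m n \<and> U * mat_adjoint U = 1\<^sub>m n"

definition orth_projection :: "complex set \<Rightarrow> nat \<Rightarrow> complex mat \<Rightarrow> bool" where
  "orth_projection F n P \<longleftrightarrow> P \<in> mats_over F n n \<and> P * P = P \<and> mat_adjoint P = P"

text \<open>
  Functional calculus for self-adjoint \<open>A\<close>; the result does not depend on the chosen unitary
  diagonalization.
\<close>

definition fun_calc :: "(real \<Rightarrow> real) \<Rightarrow> complex mat \<Rightarrow> complex mat" where
  "fun_calc f A = (THE B. \<exists>U a. unitary_mat (dim_row A) U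
     \<and> A = U * mat_diag (dim_row A) (\<lambda>i. complex_of_real (a i)) * mat_adjoint U
     \<and> B = U * mat_diag (dim_row A) (\<lambda>i. complex_of_real (f (a i))) * mat_adjoint U)"

text \<open>
  Eigenvalues of self-adjoint \<open>A\<close>, in decreasing order; the multiplicity is the one in the
  characteristic polynomial, which for self-adjoint matrices is also the geometric one.
\<close>

definition eigvals_decr :: "complex mat \<Rightarrow> real vec" where
  "eigvals_decr A = vec_of_list (THE as. sorted_wrt (\<ge>) as \<and>
     char_poly A = (\<Prod>a\<leftarrow>as. [:- complex_of_real a, 1:]))"

definition sing_vals :: "complex mat \<Rightarrow> real vec" where
  "sing_vals A = map_vec sqrt (eigvals_decr (mat_adjoint A * A))"

definition decr_rearr :: "real vec \<Rightarrow> real vec" where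
  "decr_rearr x = vec_of_list (rev (sort (list_of_vec x)))"

definition submajorized :: "real vec \<Rightarrow> real vec \<Rightarrow> bool" where
  "submajorized x y \<longleftrightarrow> dim_vec x = dim_vec y \<and>
     (\<forall>k\<in>{1..dim_vec x}. (\<Sum>i<k. decr_rearr x $ i) \<le> (\<Sum>i<k. decr_rearr y $ i))"

definition majorized :: "real vec \<Rightarrow> real vec \<Rightarrow> bool" where
  "majorized x y \<longleftrightarrow> submajorized x y \<and> (\<Sum>i<dim_vec x. x $ i) = (\<Sum>i<dim_vec y. y $ i)"

definition mat_submajorized :: "complex mat \<Rightarrow> complex mat \<Rightarrow> bool" where
  "mat_submajorized A B \<longleftrightarrow> submajorized (eigvals_decr A) (eigvals_decr B)"

definition mat_majorized :: "complex mat \<Rightarrow> complex mat \<Rightarrow> bool" where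
  "mat_majorized A B \<longleftrightarrow> majorized (eigvals_decr A) (eigvals_decr B)"

text \<open>
  A family \<open>V 1, \<dots>, V m\<close> of operators from dimension \<open>d\<close> to dimension \<open>l\<close>; it determines, and is
  determined by, its analysis operator \<open>x \<mapsto> (V 1 x, \<dots>, V m x)\<close>.
\<close>

definition frame_op :: "nat \<Rightarrow> nat \<Rightarrow> (nat \<Rightarrow> complex mat) \<Rightarrow> complex mat" where
  "frame_op m d V = matrix_sum d d {1..m} (\<lambda>i. mat_adjoint (V i) * V i)"

definition reconstruction_system ::
  "complex set \<Rightarrow> nat \<Rightarrow> nat \<Rightarrow> nat \<Rightarrow> (nat \<Rightarrow> complex mat) \<Rightarrow> bool" where
  "reconstruction_system F m l d V \<longleftrightarrow>
     (\<forall>i\<in>{1..m}. V i \<in> mats_over F l d) \<and> invertible_mat (frame_op m d V)"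

definition protocol ::
  "complex set \<Rightarrow> nat \<Rightarrow> nat \<Rightarrow> nat \<Rightarrow> (nat \<Rightarrow> complex mat) \<Rightarrow> bool" where
  "protocol F m l d V \<longleftrightarrow> reconstruction_system F m l d V \<and> frame_op m d V = 1\<^sub>m d"

definition abs_sq :: "complex mat \<Rightarrow> complex mat" where
  "abs_sq A = mat_adjoint A * A"

definition q_potential :: "nat \<Rightarrow> nat \<Rightarrow> (nat \<Rightarrow> complex mat) \<Rightarrow> complex mat" where
  "q_potential m l V =
     matrix_sum l l ({1..m} \<times> {1..m}) (\<lambda>(i, j). abs_sq (V i * mat_adjoint (V j)))"

definition projective_weights ::
  "complex set \<Rightarrow> nat \<Rightarrow> nat \<Rightarrow> (nat \<Rightarrow> complex mat) \<Rightarrow> (nat \<Rightarrow> real) \<Rightarrow> bool" where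
  "projective_weights F m d V w \<longleftrightarrow> (\<forall>i\<in>{1..m}. w i > 0 \<and>
     (\<exists>P. orth_projection F d P \<and> mat_adjoint (V i) * V i = complex_of_real (w i) \<cdot>\<^sub>m P))"

definition uwp_protocol ::
  "complex set \<Rightarrow> nat \<Rightarrow> nat \<Rightarrow> nat \<Rightarrow> (nat \<Rightarrow> complex mat) \<Rightarrow> bool" where
  "uwp_protocol F m l d V \<longleftrightarrow> protocol F m l d V \<and>
     (\<exists>w. projective_weights F m d V w \<and> (\<forall>i\<in>{1..m}. \<forall>j\<in>{1..m}. w i = w j))"

definition full_rank_system :: "nat \<Rightarrow> nat \<Rightarrow> nat \<Rightarrow> (nat \<Rightarrow> complex mat) \<Rightarrow> bool" where
  "full_rank_system m l d V \<longleftrightarrow> (\<forall>i\<in>{1..m}. vec_space.rank d (mat_adjoint (V i)) = l)"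

definition unitarily_invariant_norm :: "nat \<Rightarrow> (complex mat \<Rightarrow> real) \<Rightarrow> bool" where
  "unitarily_invariant_norm l N \<longleftrightarrow>
     (\<forall>A\<in>carrier_mat l l. 0 \<le> N A \<and> (N A = 0 \<longleftrightarrow> A = 0\<^sub>m l l)) \<and>
     (\<forall>A\<in>carrier_mat l l. \<forall>c. N (c \<cdot>\<^sub>m A) = cmod c * N A) \<and>
     (\<forall>A\<in>carrier_mat l l. \<forall>B\<in>carrier_mat l l. N (A + B) \<le> N A + N B) \<and>
     (\<forall>A\<in>carrier_mat l l. \<forall>U W. unitary_mat l U \<longrightarrow> unitary_mat l W \<longrightarrow> N (U * A * W) = N A)"

definition symmetric_gauge :: "nat \<Rightarrow> (real vec \<Rightarrow> real) \<Rightarrow> bool" where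
  "symmetric_gauge l \<psi> \<longleftrightarrow>
     (\<forall>x\<in>carrier_vec l. 0 \<le> \<psi> x \<and> (\<psi> x = 0 \<longleftrightarrow> x = 0\<^sub>v l)) \<and>
     (\<forall>x\<in>carrier_vec l. \<forall>c. \<psi> (c \<cdot>\<^sub>v x) = \<bar>c\<bar> * \<psi> x) \<and>
     (\<forall>x\<in>carrier_vec l. \<forall>y\<in>carrier_vec l. \<psi> (x + y) \<le> \<psi> x + \<psi> y) \<and>
     (\<forall>x\<in>carrier_vec l. \<forall>p. p permutes {..<l} \<longrightarrow> \<psi> (vec l (\<lambda>i. x $ p i)) = \<psi> x) \<and>
     (\<forall>x\<in>carrier_vec l. \<forall>e. (\<forall>i<l. e i \<in> {- 1, 1}) \<longrightarrow> \<psi> (vec l (\<lambda>i. e i * x $ i)) = \<psi> x)"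

definition assoc_gauge :: "nat \<Rightarrow> (complex mat \<Rightarrow> real) \<Rightarrow> (real vec \<Rightarrow> real) \<Rightarrow> bool" where
  "assoc_gauge l N \<psi> \<longleftrightarrow> symmetric_gauge l \<psi> \<and> (\<forall>A\<in>carrier_mat l l. N A = \<psi> (sing_vals A))"

definition eta :: "(real vec \<Rightarrow> real) \<Rightarrow> nat \<Rightarrow> real" where
  "eta \<psi> l = \<psi> (vec l (\<lambda>_. 1)) / real l"

definition strictly_convex_on :: "real set \<Rightarrow> (real \<Rightarrow> real) \<Rightarrow> bool" where
  "strictly_convex_on S f \<longleftrightarrow> convex S \<and>
     (\<forall>x\<in>S. \<forall>y\<in>S. \<forall>u>0. \<forall>v>0. x \<noteq> y \<longrightarrow> u + v = 1 \<longrightarrow>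
        f (u * x + v * y) < u * f x + v * f y)"

end

theory Submission
  imports Defs
begin

text \<open>
  Let \<open>S = \<Sum> V\<^sub>i\<^sup>* V\<^sub>i\<close>.  Everything reduces to the scalar inequality \<open>tr P\<^sub>q(V) \<ge> d\<close>: the constant
  vector of the average eigenvalue is majorized by the eigenvalue vector, is dominated by it in every
  symmetric gauge function (average over cyclic shifts), and Jensen's inequality holds for it.
  Since \<open>tr P\<^sub>q(V) = tr S\<^sup>2\<close> and \<open>tr (S - I)\<^sup>2 \<ge> 0\<close>, it suffices that \<open>tr S \<ge> d\<close>; this holds because an
  operator \<open>V\<^sub>i\<close> has at most \<open>l\<close> nonzero singular values, so \<open>tr V\<^sub>i\<^sup>* V\<^sub>i \<ge> d / m\<close>.  Each kind of equality
  forces \<open>tr P\<^sub>q(V) = d\<close>, hence \<open>S = I\<close> and equality for every \<open>i\<close>, that is,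
  \<open>V\<^sub>i V\<^sub>i\<^sup>* = d / (m l) I\<close>.
\<close>

section \<open>Adjoints and traces\<close>

text \<open>Both \<open>fun_calc\<close> and \<open>eigvals_decr\<close> are definite descriptions,
  so nothing spectral can be computed before a unitary diagonalization with real eigenvalues exists
  and its choice is shown to be irrelevant. Afterwards every spectral quantity is expressed by the
  eigenvalues \<open>a i\<close> of one representation
  \<open>U * real_diag n a * mat_adjoint U\<close>. The count of nonzero singular values needs no
  rank theory: it is the trace of a Hermitian idempotent of size l, and such a trace is at most l.
  With T = tr P_q(V), each of the three inequalities passes through the average T / l. Equality in
  the step from the eigenvalues to their average never has to be characterized. The other step, from
  T / l to d / l, is strictly monotone in each case (equality of sums, positive gauge of the
  all-ones vector, strictly increasing f), so any equality yields T \<le> d at once.\<close>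

lemma mult_mat_index:
  assumes "A \<in> carrier_mat nr n" "B \<in> carrier_mat n nc" "i < nr" "j < nc"
  shows "(A * B) $$ (i, j) = (\<Sum>k<n. A $$ (i, k) * B $$ (k, j))"
  using assms by (auto simp: scalar_prod_def atLeast0LessThan intro!: sum.cong)

lemma mult_mat_assoc_dim:
  fixes A B C :: "complex mat"
  assumes "dim_col A = dim_row B" "dim_col B = dim_row C"
  shows "A * B * C = A * (B * C)"
  using assms by (intro assoc_mult_mat) auto

lemma mat_diag_dim_row_col [simp]: "dim_row (mat_diag n f) = n" "dim_col (mat_diag n f) = n"
  by (simp_all add: mat_diag_def)

lemma mat_adjoint_carrier [simp]:
  "A \<in> carrier_mat r c \<Longrightarrow> mat_adjoint A \<in> carrier_mat c r"
  unfolding mat_adjoint_def by (auto simp: mat_of_rows_def)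

lemma mat_adjoint_dim [simp]:
  "dim_row (mat_adjoint A) = dim_col A" "dim_col (mat_adjoint A) = dim_row A"
  unfolding mat_adjoint_def by (auto simp: mat_of_rows_def)

lemma mat_adjoint_index [simp]:
  fixes A :: "complex mat"
  assumes "i < dim_col A" "j < dim_row A"
  shows "mat_adjoint A $$ (i, j) = cnj (A $$ (j, i))"
  using assms unfolding mat_adjoint_def by (auto simp: mat_of_rows_def)

lemma mat_adjoint_adjoint [simp]: "mat_adjoint (mat_adjoint A) = (A :: complex mat)"
  by (rule eq_matI) auto

lemma mat_adjoint_mult:
  fixes A B :: "complex mat"
  assumes A: "A \<in> carrier_mat r n" and B: "B \<in> carrier_mat n c"
  shows "mat_adjoint (A * B) = mat_adjoint B * mat_adjoint A"
proof (rule eq_matI)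
  fix i j
  assume "i < dim_row (mat_adjoint B * mat_adjoint A)" "j < dim_col (mat_adjoint B * mat_adjoint A)"
  then have i: "i < c" and j: "j < r" using A B by auto
  have "mat_adjoint (A * B) $$ (i, j) = cnj ((A * B) $$ (j, i))"
    using A B i j by (intro mat_adjoint_index) auto
  also have "\<dots> = (\<Sum>k<n. cnj (A $$ (j, k)) * cnj (B $$ (k, i)))"
    using mult_mat_index[OF A B j i] by simp
  also have "\<dots> = (\<Sum>k<n. mat_adjoint B $$ (i, k) * mat_adjoint A $$ (k, j))"
    using A B i j by (intro sum.cong) auto
  also have "\<dots> = (mat_adjoint B * mat_adjoint A) $$ (i, j)"
    using mult_mat_index[of "mat_adjoint B" c n "mat_adjoint A" r i j] A B i j by simp
  finally show "mat_adjoint (A * B) $$ (i, j) = (mat_adjoint B * mat_adjoint A) $$ (i, j)" .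
qed (use A B in auto)

lemma mat_trace_mult_comm:
  assumes A: "A \<in> carrier_mat r c" and B: "B \<in> carrier_mat c r"
  shows "mat_trace (A * B) = mat_trace (B * A)"
proof -
  have "mat_trace (A * B) = (\<Sum>i<r. \<Sum>k<c. A $$ (i, k) * B $$ (k, i))"
    unfolding mat_trace_def using A mult_mat_index[OF A B] by (auto intro!: sum.cong)
  also have "\<dots> = (\<Sum>k<c. \<Sum>i<r. B $$ (k, i) * A $$ (i, k))"
    by (subst sum.swap) (simp add: mult.commute)
  also have "\<dots> = mat_trace (B * A)"
    unfolding mat_trace_def using B mult_mat_index[OF B A] by (auto intro!: sum.cong)
  finally show ?thesis .
qed

lemma adjoint_mult_self_index:
  fixes A :: "complex mat"
  assumes A: "A \<in> carrier_mat r c" and i: "i < c"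
  shows "(mat_adjoint A * A) $$ (i, i) = complex_of_real (\<Sum>k<r. (cmod (A $$ (k, i)))\<^sup>2)"
proof -
  have "(mat_adjoint A * A) $$ (i, i) = (\<Sum>k<r. cnj (A $$ (k, i)) * A $$ (k, i))"
    using mult_mat_index[of "mat_adjoint A" c r A c i i] A i by simp
  then show ?thesis by (simp only: of_real_sum complex_norm_square mult.commute)
qed

lemma trace_adjoint_mult_self:
  fixes A :: "complex mat"
  assumes A: "A \<in> carrier_mat r c"
  shows "Re (mat_trace (mat_adjoint A * A)) = (\<Sum>i<c. \<Sum>k<r. (cmod (A $$ (k, i)))\<^sup>2)"
  unfolding mat_trace_def using A by (simp add: adjoint_mult_self_index[OF A] del: of_real_sum index_mult_mat(1))

lemma trace_adjoint_mult_self_nonneg: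
  fixes A :: "complex mat"
  shows "0 \<le> Re (mat_trace (mat_adjoint A * A))"
  by (subst trace_adjoint_mult_self[of A "dim_row A" "dim_col A"]) (auto intro!: sum_nonneg)

text \<open>Definiteness of the Frobenius norm. The form with \<open>\<le> 0\<close> accepts
  equality cases that arrive as upper bounds on a trace: it is applied to \<open>1 - P\<close> for a
  projection P and to \<open>S - 1\<close> for the frame operator S.\<close>

lemma trace_adjoint_mult_self_zero:
  fixes A :: "complex mat"
  assumes A: "A \<in> carrier_mat r c" and le: "Re (mat_trace (mat_adjoint A * A)) \<le> 0"
  shows "A = 0\<^sub>m r c"
proof -
  have "(\<Sum>i<c. \<Sum>k<r. (cmod (A $$ (k, i)))\<^sup>2) = 0"
    using le trace_adjoint_mult_self[OF A] trace_adjoint_mult_self_nonneg[of A] by linarith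
  then have "A $$ (k, i) = 0" if "k < r" "i < c" for k i
    using that by (auto simp: sum_nonneg_eq_0_iff sum_nonneg)
  then show ?thesis using A by (intro eq_matI) auto
qed

lemma unitary_mat_mult:
  assumes U: "unitary_mat n U" and W: "unitary_mat n W"
  shows "unitary_mat n (U * W)"
proof -
  have c: "U \<in> carrier_mat n n" "W \<in> carrier_mat n n"
    and e: "mat_adjoint U * U = 1\<^sub>m n" "U * mat_adjoint U = 1\<^sub>m n"
      "mat_adjoint W * W = 1\<^sub>m n" "W * mat_adjoint W = 1\<^sub>m n"
    using U W unfolding unitary_mat_def by auto
  note a = mat_adjoint_carrier[OF c(1)] mat_adjoint_carrier[OF c(2)]
  have "mat_adjoint W * mat_adjoint U * (U * W) = mat_adjoint W * (mat_adjoint U * U) * W"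
    using c[THEN carrier_matD(1)] c[THEN carrier_matD(2)] by (simp add: mult_mat_assoc_dim)
  moreover have "U * W * (mat_adjoint W * mat_adjoint U) = U * (W * mat_adjoint W) * mat_adjoint U"
    using c[THEN carrier_matD(1)] c[THEN carrier_matD(2)] by (simp add: mult_mat_assoc_dim)
  ultimately show ?thesis
    using c a e unfolding unitary_mat_def mat_adjoint_mult[OF c] by simp
qed

section \<open>Diagonalization of Hermitian matrices\<close>

text \<open>One reflection replaces an orthonormalization. The scalar \<open>c\<close> may stay
  unspecified, because a multiple of an eigenvector serves equally well in the deflation
  step.\<close>

lemma exists_unitary_with_first_column:
  fixes v :: "complex vec"
  assumes v: "v \<in> carrier_vec n" "v \<noteq> 0\<^sub>v n"
  shows "\<exists>U c. unitary_mat n U \<and> (\<forall>i<n. U $$ (i, 0) = c * v $ i)"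
proof -
  define s where "s = (\<Sum>i<n. (cmod (v $ i))\<^sup>2)"
  have n: "0 < n" using v by (cases n) auto
  have "s > 0"
  proof -
    have "s \<noteq> 0"
    proof
      assume "s = 0"
      then have "v $ i = 0" if "i < n" for i
        using that unfolding s_def by (auto simp: sum_nonneg_eq_0_iff)
      then have "v = 0\<^sub>v n" using v(1) by (intro eq_vecI) auto
      then show False using v(2) by simp
    qed
    moreover have "s \<ge> 0" unfolding s_def by (auto intro!: sum_nonneg)
    ultimately show ?thesis by simp
  qed
  define p where "p = (if v $ 0 = 0 then 1 else - cnj (sgn (v $ 0)))"
  define c where "c = p / complex_of_real (sqrt s)"
  define r where "r = - cmod (v $ 0) / sqrt s"
  have "cmod p = 1" by (simp add: p_def norm_sgn)
  then have cc: "(cmod c)\<^sup>2 = 1 / s"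
    using \<open>s > 0\<close> by (simp add: c_def norm_divide power_divide)
  define x where "x i = c * v $ i" for i
  have x0: "x 0 = complex_of_real r"
  proof -
    have "p * v $ 0 = - complex_of_real (cmod (v $ 0))"
    proof (cases "v $ 0 = 0")
      case False
      have "cnj (v $ 0) * v $ 0 = complex_of_real (cmod (v $ 0)) * complex_of_real (cmod (v $ 0))"
        by (simp only: complex_norm_square[symmetric] mult.commute of_real_power power2_eq_square[symmetric])
      then show ?thesis using False by (simp add: p_def sgn_div_norm scaleR_conv_of_real field_simps)
    qed (simp add: p_def)
    then show ?thesis by (simp add: x_def c_def r_def)
  qed
  have r: "r \<le> 0" using \<open>s > 0\<close> by (simp add: r_def)
  have sx: "(\<Sum>i<n. (cmod (x i))\<^sup>2) = 1"
    using \<open>s > 0\<close> cc unfolding x_def norm_mult power_mult_distrib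
    by (simp only: sum_distrib_left[symmetric] s_def[symmetric]) simp
  \<comment> \<open>Householder reflection exchanging the unit vectors \<open>e\<^sub>0\<close> and \<open>x\<close>; the phase \<open>p\<close> makes
    \<open>x\<^sub>0 \<le> 0\<close>, so that \<open>x \<noteq> e\<^sub>0\<close> and the reflection is Hermitian.\<close>
  define u where "u i = x i - (if i = 0 then 1 else 0)" for i :: nat
  \<comment> \<open>The coefficient 2 / |u|^2 of the reflection along u: since x is a unit vector
    with real first entry r, |u|^2 = 2 (1 - r).\<close>
  define b where "b = 1 / (1 - complex_of_real r)"
  have r1: "1 - complex_of_real r \<noteq> 0"
    using r by (metis eq_iff_diff_eq_0 not_one_le_zero of_real_1 of_real_eq_iff)
  define W where "W = mat n n (\<lambda>(i, j). (if i = j then 1 else 0) - b * u i * cnj (u j))"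
  have su: "(\<Sum>k<n. cnj (u k) * u k) = 2 * (1 - complex_of_real r)"
  proof -
    have split: "{..<n} = insert 0 {1..<n}" using n by auto
    have "(\<Sum>i<n. (cmod (u i))\<^sup>2) = (r - 1)\<^sup>2 + (\<Sum>i\<in>{1..<n}. (cmod (x i))\<^sup>2)"
    proof -
      have "cmod (complex_of_real r - 1) = \<bar>r - 1\<bar>"
        by (metis norm_of_real of_real_1 of_real_diff)
      then show ?thesis unfolding split by (simp add: u_def x0)
    qed
    moreover have "1 = r\<^sup>2 + (\<Sum>i\<in>{1..<n}. (cmod (x i))\<^sup>2)"
      using sx unfolding split by (simp add: x0)
    ultimately have "(\<Sum>i<n. (cmod (u i))\<^sup>2) = 2 * (1 - r)"
      by (simp add: power2_eq_square algebra_simps)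
    moreover have "(\<Sum>k<n. cnj (u k) * u k) = complex_of_real (\<Sum>i<n. (cmod (u i))\<^sup>2)"
      by (simp only: of_real_sum complex_norm_square mult.commute)
    ultimately show ?thesis by simp
  qed
  have Wc: "W \<in> carrier_mat n n" by (simp add: W_def)
  have Wa: "mat_adjoint W = W"
  proof (rule eq_matI)
    have "cnj b = b" by (simp add: b_def)
    then show "mat_adjoint W $$ (i, j) = W $$ (i, j)" if "i < dim_row W" "j < dim_col W" for i j
      using that Wc by (auto simp: W_def)
  qed (use Wc in auto)
  have "W * W = 1\<^sub>m n"
  proof (rule eq_matI)
    fix i j assume "i < dim_row (1\<^sub>m n :: complex mat)" "j < dim_col (1\<^sub>m n :: complex mat)"
    then have i: "i < n" and j: "j < n" by auto
    have "(W * W) $$ (i, j) = (\<Sum>k<n. ((if i = k then 1 else 0) - b * u i * cnj (u k)) *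
        ((if k = j then 1 else 0) - b * u k * cnj (u j)))"
      using mult_mat_index[OF Wc Wc i j] i j by (simp add: W_def)
    also have "\<dots> = (\<Sum>k<n. (if k = i then (if i = j then 1 else 0) - b * u i * cnj (u j) else 0)
        - (if k = j then b * u i * cnj (u j) else 0)
        + b * b * u i * cnj (u j) * (cnj (u k) * u k))"
      by (intro sum.cong) (auto simp: algebra_simps)
    also have "\<dots> = (if i = j then 1 else 0) - 2 * b * u i * cnj (u j)
        + b * b * u i * cnj (u j) * (\<Sum>k<n. cnj (u k) * u k)"
      using i j by (simp add: sum.distrib sum_subtractf sum_distrib_left)
    also have "\<dots> = (if i = j then 1 else 0)"
    proof -
      have "b * (1 - complex_of_real r) = 1" using r1 by (simp add: b_def)
      moreover have "b * b * u i * cnj (u j) * (2 * (1 - complex_of_real r))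
          = 2 * b * u i * cnj (u j) * (b * (1 - complex_of_real r))"
        by (simp only: mult_ac)
      ultimately have "b * b * u i * cnj (u j) * (2 * (1 - complex_of_real r)) = 2 * b * u i * cnj (u j)"
        by simp
      then show ?thesis unfolding su by simp
    qed
    finally show "(W * W) $$ (i, j) = 1\<^sub>m n $$ (i, j)" using i j by simp
  qed (use Wc in auto)
  then have "unitary_mat n W" using Wc Wa by (simp add: unitary_mat_def)
  moreover have "W $$ (i, 0) = c * v $ i" if "i < n" for i
  proof -
    \<comment> \<open>Here u_0 = r - 1, so the first column of W is e_0 + u, which is x.\<close>
    have "b * cnj (u 0) = -1"
      using r1 by (simp add: u_def x0 b_def field_simps)
    moreover have "b * u i * cnj (u 0) = (b * cnj (u 0)) * u i" by (simp only: mult_ac)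
    ultimately have "b * u i * cnj (u 0) = - u i" by simp
    then have "W $$ (i, 0) = (if i = 0 then 1 else 0) + u i"
      using that n by (simp add: W_def)
    then show ?thesis by (simp add: u_def x_def)
  qed
  ultimately show ?thesis by blast
qed

text \<open>Conjugation by a unitary whose first column is an eigenvector clears the first column
  below the diagonal. Hermitian symmetry then clears the first row and makes the eigenvalue real,
  and the remaining block is Hermitian again, ready for induction.\<close>

lemma hermitian_deflation:
  fixes A :: "complex mat"
  assumes A: "A \<in> carrier_mat (Suc n) (Suc n)" and H: "mat_adjoint A = A"
  shows "\<exists>W B e. unitary_mat (Suc n) W \<and> B \<in> carrier_mat n n \<and> mat_adjoint B = B \<and>
    A = W * four_block_mat (mat 1 1 (\<lambda>_. complex_of_real e)) (0\<^sub>m 1 n) (0\<^sub>m n 1) B * mat_adjoint W"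
proof -
  let ?N = "Suc n"
  obtain as where as: "char_poly A = (\<Prod>a\<leftarrow>as. [:- a, 1:])" "length as = ?N"
    using char_poly_factorized[OF A] by auto
  then obtain ev where "poly (char_poly A) ev = 0"
    by (cases as) auto
  then have "eigenvalue A ev" using eigenvalue_root_char_poly[OF A] by simp
  then obtain v where v: "v \<in> carrier_vec ?N" "v \<noteq> 0\<^sub>v ?N" "A *\<^sub>v v = ev \<cdot>\<^sub>v v"
    using A unfolding eigenvalue_def eigenvector_def by auto
  obtain W c where W: "unitary_mat ?N W" and W0: "\<And>i. i < ?N \<Longrightarrow> W $$ (i, 0) = c * v $ i"
    using exists_unitary_with_first_column[OF v(1,2)] by blast
  have Wc: "W \<in> carrier_mat ?N ?N" and Wu: "mat_adjoint W * W = 1\<^sub>m ?N" "W * mat_adjoint W = 1\<^sub>m ?N"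
    using W by (auto simp: unitary_mat_def)
  note Wa = mat_adjoint_carrier[OF Wc]
  define C where "C = mat_adjoint W * (A * W)"
  have Cc: "C \<in> carrier_mat ?N ?N" unfolding C_def using A Wc Wa by auto
  have CH: "mat_adjoint C = C"
  proof -
    have "mat_adjoint C = mat_adjoint (A * W) * W"
      unfolding C_def using mat_adjoint_mult[OF Wa, of "A * W" ?N] A Wc by simp
    also have "mat_adjoint (A * W) = mat_adjoint W * A"
      using mat_adjoint_mult[OF A Wc] H by simp
    finally show ?thesis unfolding C_def using A Wc Wa assoc_mult_mat by metis
  qed
  have AC: "A = W * C * mat_adjoint W"
  proof -
    have "W * C * mat_adjoint W = (W * mat_adjoint W) * A * (W * mat_adjoint W)"
      unfolding C_def using A Wc by (simp add: mult_mat_assoc_dim)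
    then show ?thesis using Wu A by simp
  qed
  have AW: "(A * W) $$ (k, 0) = ev * W $$ (k, 0)" if k: "k < ?N" for k
  proof -
    have "(A * W) $$ (k, 0) = (\<Sum>j<?N. A $$ (k, j) * (c * v $ j))"
      using mult_mat_index[OF A Wc k, of 0] W0 by simp
    also have "\<dots> = c * (\<Sum>j<?N. A $$ (k, j) * v $ j)"
      by (simp add: sum_distrib_left algebra_simps)
    also have "(\<Sum>j<?N. A $$ (k, j) * v $ j) = (A *\<^sub>v v) $ k"
      using A v(1) k by (auto simp: scalar_prod_def atLeast0LessThan intro!: sum.cong)
    also have "\<dots> = ev * v $ k" using v k by simp
    finally show ?thesis using W0[OF k] by simp
  qed
  have C0: "C $$ (i, 0) = (if i = 0 then ev else 0)" if i: "i < ?N" for i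
  proof -
    have "C $$ (i, 0) = (\<Sum>k<?N. mat_adjoint W $$ (i, k) * (ev * W $$ (k, 0)))"
      unfolding C_def using mult_mat_index[OF Wa, of "A * W" ?N i 0] A Wc AW i
      by (auto intro!: sum.cong)
    also have "\<dots> = ev * (\<Sum>k<?N. mat_adjoint W $$ (i, k) * W $$ (k, 0))"
      by (simp add: sum_distrib_left algebra_simps)
    also have "\<dots> = ev * (mat_adjoint W * W) $$ (i, 0)"
      using mult_mat_index[OF Wa Wc i, of 0] by simp
    finally show ?thesis using i by (simp add: Wu)
  qed
  have Csym: "C $$ (i, j) = cnj (C $$ (j, i))" if "i < ?N" "j < ?N" for i j
    using mat_adjoint_index[of i C j] that Cc CH by simp
  have C0': "C $$ (0, i) = (if i = 0 then ev else 0)" if i: "i < ?N" for i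
    using Csym[of 0 i] C0[OF i] Csym[of 0 0] C0[of 0] i by auto
  have "ev = cnj ev" using Csym[of 0 0] C0[of 0] by simp
  then obtain e where e: "ev = complex_of_real e" by (metis Reals_cnj_iff Reals_cases)
  define B where "B = mat n n (\<lambda>(i, j). C $$ (Suc i, Suc j))"
  have Bc: "B \<in> carrier_mat n n" by (simp add: B_def)
  have "mat_adjoint B = B"
    using Bc by (intro eq_matI) (auto simp: B_def intro!: Csym[symmetric])
  moreover have "C = four_block_mat (mat 1 1 (\<lambda>_. complex_of_real e)) (0\<^sub>m 1 n) (0\<^sub>m n 1) B"
    using Cc Bc C0 C0' e by (intro eq_matI) (auto simp: B_def)
  ultimately show ?thesis using W Bc AC by blast
qed

lemma mat_adjoint_four_block:
  fixes A :: "complex mat"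
  assumes "A \<in> carrier_mat r1 c1" "B \<in> carrier_mat r1 c2" "C \<in> carrier_mat r2 c1" "D \<in> carrier_mat r2 c2"
  shows "mat_adjoint (four_block_mat A B C D) =
    four_block_mat (mat_adjoint A) (mat_adjoint C) (mat_adjoint B) (mat_adjoint D)"
  using assms by (intro eq_matI) auto

theorem hermitian_diagonalization:
  fixes A :: "complex mat"
  assumes "A \<in> carrier_mat n n" and "mat_adjoint A = A"
  shows "\<exists>U a. unitary_mat n U \<and>
    A = U * mat_diag n (\<lambda>i. complex_of_real (a i)) * mat_adjoint U"
  using assms
proof (induction n arbitrary: A)
  case 0
  then show ?case
    by (intro exI[of _ "1\<^sub>m 0"] exI[of _ "\<lambda>_. 0"]) (auto simp: unitary_mat_def)
next
  case (Suc n)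
  let ?N = "Suc n"
  obtain W B e where W: "unitary_mat ?N W" and B: "B \<in> carrier_mat n n" "mat_adjoint B = B"
    and A: "A = W * four_block_mat (mat 1 1 (\<lambda>_. complex_of_real e)) (0\<^sub>m 1 n) (0\<^sub>m n 1) B * mat_adjoint W"
    using hermitian_deflation[OF Suc.prems] by blast
  obtain U a where U: "unitary_mat n U"
    and BU: "B = U * mat_diag n (\<lambda>i. complex_of_real (a i)) * mat_adjoint U"
    using Suc.IH[OF B] by blast
  have Uc: "U \<in> carrier_mat n n" and Uu: "mat_adjoint U * U = 1\<^sub>m n" "U * mat_adjoint U = 1\<^sub>m n"
    using U by (auto simp: unitary_mat_def)
  have Wc: "W \<in> carrier_mat ?N ?N" using W by (auto simp: unitary_mat_def)
  define d where "d = (\<lambda>i. case i of 0 \<Rightarrow> e | Suc j \<Rightarrow> a j)"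
  let ?e = "mat 1 1 (\<lambda>_. complex_of_real e)"
  let ?D = "mat_diag n (\<lambda>i. complex_of_real (a i))"
  let ?D' = "mat_diag ?N (\<lambda>i. complex_of_real (d i))"
  \<comment> \<open>Bordering the unitary of the smaller block by 1 keeps it unitary, and
    \<open>W * X\<close> diagonalizes the whole matrix.\<close>
  define X where "X = four_block_mat (1\<^sub>m 1) (0\<^sub>m 1 n) (0\<^sub>m n 1) U"
  have Xc: "X \<in> carrier_mat ?N ?N"
    using Uc four_block_carrier_mat[of "1\<^sub>m 1" 1 1 U n n] by (simp add: X_def)
  have a1: "mat_adjoint (1\<^sub>m k) = (1\<^sub>m k :: complex mat)"
    "mat_adjoint (0\<^sub>m k l) = (0\<^sub>m l k :: complex mat)" for k l
    by (intro eq_matI; auto)+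
  have Xa: "mat_adjoint X = four_block_mat (1\<^sub>m 1) (0\<^sub>m 1 n) (0\<^sub>m n 1) (mat_adjoint U)"
    unfolding X_def using Uc by (subst mat_adjoint_four_block[where ?r1.0=1 and ?c1.0=1]) (auto simp: a1)
  have D': "?D' = four_block_mat ?e (0\<^sub>m 1 n) (0\<^sub>m n 1) ?D"
    by (intro eq_matI) (auto simp: d_def mat_diag_def split: nat.splits)
  have 1: "four_block_mat (1\<^sub>m 1) (0\<^sub>m 1 n) (0\<^sub>m n 1) (1\<^sub>m n) = (1\<^sub>m ?N :: complex mat)"
    by (intro eq_matI) auto
  note mul = mult_four_block_mat[of _ 1 1 _ n _ n _ _ 1 _ n]
  have X: "unitary_mat ?N X"
    unfolding unitary_mat_def Xa using Xc unfolding X_def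
    by (auto simp: mul Uc Uu 1 right_mult_zero_mat[of _ n n] left_mult_zero_mat[of _ n n])
  have BX: "four_block_mat ?e (0\<^sub>m 1 n) (0\<^sub>m n 1) B = X * ?D' * mat_adjoint X"
    unfolding Xa D' unfolding X_def BU using Uc
    by (auto simp: mul right_mult_zero_mat[of _ n n] left_mult_zero_mat[of _ n n])
  have "A = (W * X) * ?D' * mat_adjoint (W * X)"
    unfolding A BX mat_adjoint_mult[OF Wc Xc]
    using Wc Xc by (simp add: mult_mat_assoc_dim)
  then show ?case using unitary_mat_mult[OF W X] by blast
qed

section \<open>Functional calculus and eigenvalues\<close>

abbreviation real_diag :: "nat \<Rightarrow> (nat \<Rightarrow> real) \<Rightarrow> complex mat" where
  "real_diag n a \<equiv> mat_diag n (\<lambda>i. complex_of_real (a i))"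

lemma mat_adjoint_real_diag [simp]: "mat_adjoint (real_diag n a) = real_diag n a"
  by (rule eq_matI) (auto simp: mat_diag_def)

lemma mat_adjoint_one [simp]: "mat_adjoint (1\<^sub>m n) = (1\<^sub>m n :: complex mat)"
  by (rule eq_matI) auto

lemma mat_trace_real_diag: "mat_trace (real_diag n a) = complex_of_real (\<Sum>i<n. a i)"
  by (simp add: mat_trace_def mat_diag_def)

lemma mat_trace_unitary_conj:
  assumes U: "unitary_mat n U" and D: "D \<in> carrier_mat n n"
  shows "mat_trace (U * D * mat_adjoint U) = mat_trace D"
proof -
  have Uc: "U \<in> carrier_mat n n" and Uu: "mat_adjoint U * U = 1\<^sub>m n"
    using U by (auto simp: unitary_mat_def)
  have "mat_trace (U * D * mat_adjoint U) = mat_trace (mat_adjoint U * (U * D))"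
    using Uc D by (intro mat_trace_mult_comm[of _ n n]) auto
  also have "mat_adjoint U * (U * D) = (mat_adjoint U * U) * D"
    using Uc D by (simp add: mult_mat_assoc_dim)
  also have "\<dots> = D" using Uu D by simp
  finally show ?thesis .
qed

text \<open>The matrix \<open>X = mat_adjoint W * U\<close> intertwines the two diagonals, so a
  nonzero entry \<open>X $$ (i, j)\<close> forces \<open>a j = b i\<close> and therefore
  \<open>f (a j) = f (b i)\<close>. Hence X intertwines the images under an arbitrary f, with no
  polynomial approximation. This is the uniqueness behind \<open>fun_calc\<close>.\<close>

lemma unitary_conj_real_diag_unique:
  assumes U: "unitary_mat n U" and W: "unitary_mat n W"
    and eq: "U * real_diag n a * mat_adjoint U = W * real_diag n b * mat_adjoint W"
  shows "U * real_diag n (\<lambda>i. f (a i)) * mat_adjoint U = W * real_diag n (\<lambda>i. f (b i)) * mat_adjoint W"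
proof -
  have Uc: "U \<in> carrier_mat n n" and Uu: "mat_adjoint U * U = 1\<^sub>m n" "U * mat_adjoint U = 1\<^sub>m n"
    using U by (auto simp: unitary_mat_def)
  have Wc: "W \<in> carrier_mat n n" and Wu: "mat_adjoint W * W = 1\<^sub>m n" "W * mat_adjoint W = 1\<^sub>m n"
    using W by (auto simp: unitary_mat_def)
  define X where "X = mat_adjoint W * U"
  have Xc: "X \<in> carrier_mat n n" using Uc Wc by (auto simp: X_def)
  have "X * real_diag n a = mat_adjoint W * (U * real_diag n a * mat_adjoint U) * U"
    using Uc Wc Uu by (simp add: X_def mult_mat_assoc_dim)
  also have "\<dots> = (mat_adjoint W * W) * real_diag n b * X"
    unfolding eq using Uc Wc by (simp add: X_def mult_mat_assoc_dim)
  also have "\<dots> = real_diag n b * X"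
    unfolding Wu by (simp add: left_mult_one_mat[of _ n n])
  finally have comm: "X * real_diag n a = real_diag n b * X" .
  have ent: "X $$ (i, j) * complex_of_real (a j) = complex_of_real (b i) * X $$ (i, j)"
    if "i < n" "j < n" for i j
    using arg_cong[OF comm, of "\<lambda>M. M $$ (i, j)"] that Xc
    by (simp add: mat_diag_mult_left[OF Xc] mat_diag_mult_right[OF Xc])
  have "X $$ (i, j) * complex_of_real (f (a j)) = complex_of_real (f (b i)) * X $$ (i, j)"
    if "i < n" "j < n" for i j
    using ent[OF that] by (cases "X $$ (i, j) = 0") auto
  then have comm': "X * real_diag n (\<lambda>i. f (a i)) = real_diag n (\<lambda>i. f (b i)) * X"
    unfolding mat_diag_mult_left[OF Xc] mat_diag_mult_right[OF Xc] by (intro eq_matI) auto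
  have "U * real_diag n (\<lambda>i. f (a i)) * mat_adjoint U
      = (W * mat_adjoint W) * U * real_diag n (\<lambda>i. f (a i)) * mat_adjoint U"
    unfolding Wu using Uc by simp
  also have "\<dots> = W * (X * real_diag n (\<lambda>i. f (a i))) * mat_adjoint U"
    using Uc Wc by (simp add: X_def mult_mat_assoc_dim)
  also have "\<dots> = W * real_diag n (\<lambda>i. f (b i)) * mat_adjoint W * (U * mat_adjoint U)"
    unfolding comm' using Uc Wc by (simp add: X_def mult_mat_assoc_dim)
  also have "\<dots> = W * real_diag n (\<lambda>i. f (b i)) * mat_adjoint W"
    unfolding Uu using Wc by (simp add: right_mult_one_mat[of _ n n])
  finally show ?thesis .
qed

lemma fun_calc_diagonalized:
  assumes U: "unitary_mat n U" and A: "A = U * real_diag n a * mat_adjoint U"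
  shows "fun_calc f A = U * real_diag n (\<lambda>i. f (a i)) * mat_adjoint U"
proof -
  have n: "dim_row A = n" using U by (auto simp: A unitary_mat_def)
  show ?thesis
    unfolding fun_calc_def n
  proof (rule the_equality)
    fix B
    assume "\<exists>W b. unitary_mat n W \<and> A = W * real_diag n b * mat_adjoint W
      \<and> B = W * real_diag n (\<lambda>i. f (b i)) * mat_adjoint W"
    then obtain W b where W: "unitary_mat n W" and "A = W * real_diag n b * mat_adjoint W"
      and "B = W * real_diag n (\<lambda>i. f (b i)) * mat_adjoint W" by blast
    then show "B = U * real_diag n (\<lambda>i. f (a i)) * mat_adjoint U"
      using unitary_conj_real_diag_unique[OF U W, of a b f] A by simp
  qed (use U A in blast)
qed

lemma trace_fun_calc_diagonalized:
  assumes U: "unitary_mat n U" and A: "A = U * real_diag n a * mat_adjoint U"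
  shows "Re (mat_trace (fun_calc f A)) = (\<Sum>i<n. f (a i))"
  unfolding fun_calc_diagonalized[OF assms]
  by (simp add: mat_trace_unitary_conj[OF U] mat_trace_real_diag)

lemma char_poly_diagonalized:
  assumes U: "unitary_mat n U" and A: "A = U * real_diag n a * mat_adjoint U"
  shows "char_poly A = (\<Prod>x\<leftarrow>map a [0..<n]. [:- complex_of_real x, 1:])"
proof -
  have Uc: "U \<in> carrier_mat n n" using U by (auto simp: unitary_mat_def)
  have "similar_mat A (real_diag n a)"
    using U Uc A by (intro similar_matI[of _ _ U "mat_adjoint U" n]) (auto simp: unitary_mat_def)
  then have "char_poly A = char_poly (real_diag n a)" by (rule char_poly_similar)
  also have "\<dots> = (\<Prod>x\<leftarrow>diag_mat (real_diag n a). [:- x, 1:])"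
    by (rule char_poly_upper_triangular[of _ n]) (auto simp: mat_diag_def)
  also have "diag_mat (real_diag n a) = map (\<lambda>i. complex_of_real (a i)) [0..<n]"
    by (auto simp: diag_mat_def mat_diag_def)
  finally show ?thesis by (simp add: o_def)
qed

text \<open>The factors are recovered as roots with multiplicity. This gives the uniqueness behind
  \<open>eigvals_decr\<close>, since a sorted list is determined by its multiset.\<close>

lemma mset_eq_if_linear_factors_eq:
  assumes "(\<Prod>x\<leftarrow>as. [:- complex_of_real x, 1:]) = (\<Prod>x\<leftarrow>bs. [:- complex_of_real x, 1:])"
  shows "mset as = mset bs"
proof -
  have p: "proots (\<Prod>x\<leftarrow>cs. [:- complex_of_real x, 1:]) = mset (map complex_of_real cs)" for cs
  proof -
    have nz: "(\<Prod>x\<leftarrow>cs. [:- complex_of_real x, 1:]) \<noteq> 0" for cs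
      by (auto simp: prod_list_zero_iff)
    have lin: "proots [:- complex_of_real x, 1:] = {#complex_of_real x#}" for x
      using proots_linear_factor[of "complex_of_real x"] by simp
    show ?thesis
    proof (induction cs)
      case (Cons c cs)
      have "proots ([:- complex_of_real c, 1:] * (\<Prod>x\<leftarrow>cs. [:- complex_of_real x, 1:]))
        = {#complex_of_real c#} + mset (map complex_of_real cs)"
        using nz[of cs] Cons.IH lin[of c] by (subst proots_mult) auto
      then show ?case by (simp del: mult_pCons_left)
    qed simp
  qed
  have "image_mset complex_of_real (mset as) = image_mset complex_of_real (mset bs)"
    using p[of as] p[of bs] assms by simp
  then show ?thesis
    by (rule multiset.inj_map_strong[rotated]) auto
qed

lemma eigvals_decr_diagonalized:
  assumes U: "unitary_mat n U" and A: "A = U * real_diag n a * mat_adjoint U"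
  shows "eigvals_decr A = vec_of_list (rev (sort (map a [0..<n])))"
proof -
  let ?xs = "map a [0..<n]"
  note cp = char_poly_diagonalized[OF assms]
  have "(THE as. sorted_wrt (\<ge>) as \<and> char_poly A = (\<Prod>a\<leftarrow>as. [:- complex_of_real a, 1:]))
    = rev (sort ?xs)"
  proof (rule the_equality)
    have "(\<Prod>x\<leftarrow>rev (sort ?xs). [:- complex_of_real x, 1:]) = (\<Prod>x\<leftarrow>?xs. [:- complex_of_real x, 1:])"
      by (simp only: prod_mset_prod_list[symmetric] mset_map mset_rev mset_sort)
    then show "sorted_wrt (\<ge>) (rev (sort ?xs)) \<and>
        char_poly A = (\<Prod>a\<leftarrow>rev (sort ?xs). [:- complex_of_real a, 1:])"
      using cp by (simp add: sorted_wrt_rev)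
  next
    fix as assume as: "sorted_wrt (\<ge>) as \<and> char_poly A = (\<Prod>a\<leftarrow>as. [:- complex_of_real a, 1:])"
    then have "mset (rev as) = mset ?xs"
      using cp mset_eq_if_linear_factors_eq[of as ?xs] by simp
    moreover have "sorted (rev as)" using as by (simp add: sorted_wrt_rev)
    ultimately have "sort ?xs = rev as" by (rule properties_for_sort)
    then show "as = rev (sort ?xs)" by simp
  qed
  then show ?thesis by (simp add: eigvals_decr_def)
qed

section \<open>Comparison with constant vectors\<close>

text \<open>\<open>submajorized\<close> rearranges vectors that \<open>eigvals_decr\<close> has
  already put in decreasing order; the second rearrangement changes nothing.\<close>

lemma decr_rearr_rev_sort:
  "decr_rearr (vec_of_list (rev (sort xs))) = vec_of_list (rev (sort xs))"
proof -
  have "sort (rev (sort xs)) = sort xs" by (rule properties_for_sort) auto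
  then show ?thesis by (simp add: decr_rearr_def list_vec)
qed

text \<open>The entry \<open>y (k - 1)\<close> is a pivot: the first k entries are at least as
  large, the remaining n - k at most as large. Comparing the averages of the two segments with it
  gives the claim, cross-multiplied to avoid division.\<close>

lemma sum_initial_segment_ge_average:
  fixes y :: "nat \<Rightarrow> real"
  assumes dec: "\<And>i j. i \<le> j \<Longrightarrow> j < n \<Longrightarrow> y j \<le> y i" and k: "1 \<le> k" "k \<le> n"
  shows "real k * (\<Sum>i<n. y i) \<le> real n * (\<Sum>i<k. y i)"
proof -
  have "(\<Sum>i<k. y (k - 1)) \<le> (\<Sum>i<k. y i)"
    using k by (intro sum_mono dec) auto
  then have lo: "real k * y (k - 1) \<le> (\<Sum>i<k. y i)" by simp
  have "(\<Sum>i=k..<n. y i) \<le> (\<Sum>i=k..<n. y (k - 1))"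
    by (intro sum_mono dec) auto
  then have hi: "(\<Sum>i=k..<n. y i) \<le> real (n - k) * y (k - 1)" by simp
  have split: "(\<Sum>i<n. y i) = (\<Sum>i<k. y i) + (\<Sum>i=k..<n. y i)"
    using sum.atLeastLessThan_concat[of 0 k n y] k by (simp add: atLeast0LessThan)
  have "real k * (\<Sum>i=k..<n. y i) \<le> real k * (real (n - k) * y (k - 1))"
    using hi by (intro mult_left_mono) auto
  also have "\<dots> = real (n - k) * (real k * y (k - 1))" by simp
  also have "\<dots> \<le> real (n - k) * (\<Sum>i<k. y i)"
    using lo by (intro mult_left_mono) auto
  finally show ?thesis using k by (simp add: split of_nat_diff algebra_simps)
qed

lemma submajorized_const:
  assumes len: "length xs = n" and sum: "real n * c \<le> sum_list xs"
  shows "submajorized (vec_of_list (replicate n c)) (vec_of_list (rev (sort xs)))"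
proof -
  let ?ys = "rev (sort xs)"
  have c: "decr_rearr (vec_of_list (replicate n c)) = vec_of_list (replicate n c)"
    using decr_rearr_rev_sort[of "replicate n c"] by (simp add: sorted_sort_id sorted_replicate)
  have dec: "?ys ! j \<le> ?ys ! i" if "i \<le> j" "j < n" for i j
    using sorted_rev_nth_mono[of ?ys i j] that len by simp
  have "sum_list ?ys = sum_list xs"
    by (simp only: sum_mset_sum_list[symmetric] mset_rev mset_sort)
  then have s: "(\<Sum>i<n. ?ys ! i) = sum_list xs"
    using len by (simp add: sum_list_sum_nth atLeast0LessThan)
  have "real k * c \<le> (\<Sum>i<k. ?ys ! i)" if k: "1 \<le> k" "k \<le> n" for k
  proof -
    have "real k * (real n * c) \<le> real k * (\<Sum>i<n. ?ys ! i)"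
      using sum s by (intro mult_left_mono) auto
    also have "\<dots> \<le> real n * (\<Sum>i<k. ?ys ! i)"
      using dec k by (intro sum_initial_segment_ge_average)
    finally have "real n * (real k * c) \<le> real n * (\<Sum>i<k. ?ys ! i)"
      by (simp only: mult_ac)
    then show ?thesis using k by (simp add: mult_le_cancel_left)
  qed
  then show ?thesis
    unfolding submajorized_def c decr_rearr_rev_sort
    using len by (auto simp: vec_of_list_index)
qed

lemma eigvals_decr_scalar:
  "eigvals_decr (complex_of_real c \<cdot>\<^sub>m 1\<^sub>m n) = vec_of_list (replicate n c)"
proof -
  have "complex_of_real c \<cdot>\<^sub>m 1\<^sub>m n = 1\<^sub>m n * real_diag n (\<lambda>_. c) * mat_adjoint (1\<^sub>m n)"
    by (simp add: left_mult_one_mat[of _ n n] right_mult_one_mat[of _ n n])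
      (rule eq_matI; auto simp: mat_diag_def)
  from eigvals_decr_diagonalized[OF _ this] show ?thesis
    by (simp add: unitary_mat_def map_replicate_const sorted_sort_id sorted_replicate)
qed

lemma sum_vec_of_list: "(\<Sum>i<length xs. vec_of_list xs $ i) = sum_list (xs :: real list)"
  by (simp add: vec_of_list_index sum_list_sum_nth atLeast0LessThan)

lemma sum_list_rev_sort: "sum_list (rev (sort xs)) = sum_list (xs :: real list)"
  by (simp only: sum_mset_sum_list[symmetric] mset_rev mset_sort)

lemma mat_majorized_scalar_iff:
  assumes U: "unitary_mat n U" and A: "A = U * real_diag n a * mat_adjoint U"
    and le: "real n * c \<le> (\<Sum>i<n. a i)"
  shows "mat_submajorized (complex_of_real c \<cdot>\<^sub>m 1\<^sub>m n) A"
    and "mat_majorized (complex_of_real c \<cdot>\<^sub>m 1\<^sub>m n) A \<longleftrightarrow> real n * c = (\<Sum>i<n. a i)"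
proof -
  let ?xs = "map a [0..<n]"
  have s: "sum_list ?xs = (\<Sum>i<n. a i)"
    by (simp add: sum_list_sum_nth atLeast0LessThan)
  show sub: "mat_submajorized (complex_of_real c \<cdot>\<^sub>m 1\<^sub>m n) A"
    unfolding mat_submajorized_def eigvals_decr_scalar eigvals_decr_diagonalized[OF U A]
    using le s by (intro submajorized_const) auto
  have "(\<Sum>i<n. vec_of_list (rev (sort ?xs)) $ i) = (\<Sum>i<n. a i)"
    using sum_vec_of_list[of "rev (sort ?xs)"] sum_list_rev_sort[of ?xs] s by simp
  moreover have "(\<Sum>i<n. vec_of_list (replicate n c) $ i) = real n * c"
    by (simp add: vec_of_list_index)
  ultimately show "mat_majorized (complex_of_real c \<cdot>\<^sub>m 1\<^sub>m n) A \<longleftrightarrow> real n * c = (\<Sum>i<n. a i)"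
    using sub unfolding mat_majorized_def majorized_def mat_submajorized_def
      eigvals_decr_scalar eigvals_decr_diagonalized[OF U A] by simp
qed

section \<open>Symmetric gauge functions: averaging over cyclic shifts\<close>

text \<open>The branch \<open>else i\<close> is there because \<open>permutes\<close> demands fixed
  points outside the set. Injectivity holds since two indices below l with equal residues after the
  shift differ by a multiple of l.\<close>

lemma cyclic_shift_permutes:
  fixes k l :: nat
  shows "(\<lambda>i. if i < l then (i + k) mod l else i) permutes {..<l}" (is "?p permutes _")
proof (rule bij_imp_permutes)
  have "inj_on ?p {..<l}"
  proof -
    have aux: False if "i < j" "j < l" "(i + k) mod l = (j + k) mod l" for i j
    proof -
      have "l dvd (j + k) - (i + k)"
        using that mod_eq_dvd_iff_nat[of "i + k" "j + k" l] by simp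
      then have "l dvd j - i" by simp
      then show False using that dvd_imp_le[of l "j - i"] by auto
    qed
    show ?thesis
    proof (rule inj_onI)
      fix i j assume "i \<in> {..<l}" "j \<in> {..<l}" "?p i = ?p j"
      then show "i = j" using aux[of i j] aux[of j i] by (cases i j rule: linorder_cases) auto
    qed
  qed
  moreover have "?p ` {..<l} \<subseteq> {..<l}" by auto
  ultimately show "bij_betw ?p {..<l} {..<l}"
    unfolding bij_betw_def by (metis endo_inj_surj finite_lessThan)
qed auto

text \<open>The l cyclic shifts of x all have the gauge of x, and in their sum each coordinate is
  the full sum of the entries, so that sum is a multiple of the all-ones vector.\<close>

lemma symmetric_gauge_ge_average:
  assumes g: "symmetric_gauge l \<psi>" and x: "x \<in> carrier_vec l" and l: "0 < l"
  shows "\<bar>(\<Sum>i<l. x $ i)\<bar> / real l * \<psi> (vec l (\<lambda>_. 1)) \<le> \<psi> x"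
proof -
  have scale: "\<psi> (c \<cdot>\<^sub>v y) = \<bar>c\<bar> * \<psi> y" if "y \<in> carrier_vec l" for y c
    using g that unfolding symmetric_gauge_def by blast
  have add: "\<psi> (y + z) \<le> \<psi> y + \<psi> z" if "y \<in> carrier_vec l" "z \<in> carrier_vec l" for y z
    using g that unfolding symmetric_gauge_def by blast
  have perm: "\<psi> (vec l (\<lambda>i. x $ p i)) = \<psi> x" if "p permutes {..<l}" for p
    using g x that unfolding symmetric_gauge_def by blast
  have shift: "\<psi> (vec l (\<lambda>i. x $ ((i + k) mod l))) = \<psi> x" for k
  proof -
    have "vec l (\<lambda>i. x $ ((i + k) mod l)) = vec l (\<lambda>i. x $ (if i < l then (i + k) mod l else i))"
      by (intro eq_vecI) auto
    then show ?thesis using perm[OF cyclic_shift_permutes] by simp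
  qed
  \<comment> \<open>Induction on the number of shifts extends subadditivity to many summands; the
    sum of vectors is formed coordinatewise.\<close>
  have sums: "\<psi> (vec l (\<lambda>i. \<Sum>j<k. x $ ((i + j) mod l))) \<le> real k * \<psi> x" for k
  proof (induction k)
    case 0
    have "vec l (\<lambda>i. \<Sum>j<0. x $ ((i + j) mod l)) = 0\<^sub>v l" by (intro eq_vecI) auto
    moreover have "\<psi> (0\<^sub>v l) = 0" using g unfolding symmetric_gauge_def by auto
    ultimately show ?case by simp
  next
    case (Suc k)
    have "vec l (\<lambda>i. \<Sum>j<Suc k. x $ ((i + j) mod l))
      = vec l (\<lambda>i. \<Sum>j<k. x $ ((i + j) mod l)) + vec l (\<lambda>i. x $ ((i + k) mod l))"
      by (intro eq_vecI) auto
    then show ?case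
      using add[of "vec l (\<lambda>i. \<Sum>j<k. x $ ((i + j) mod l))" "vec l (\<lambda>i. x $ ((i + k) mod l))"]
        shift[of k] Suc.IH by (simp add: algebra_simps)
  qed
  have "(\<Sum>j<l. x $ ((i + j) mod l)) = (\<Sum>j<l. x $ j)" for i
  proof -
    have "(\<Sum>j<l. x $ j) = (\<Sum>j<l. x $ (if j < l then (j + i) mod l else j))"
      using sum.permute[OF cyclic_shift_permutes, of "\<lambda>j. x $ j" l i] by (simp add: o_def)
    then show ?thesis by (simp add: add.commute)
  qed
  then have "vec l (\<lambda>i. \<Sum>j<l. x $ ((i + j) mod l)) = (\<Sum>j<l. x $ j) \<cdot>\<^sub>v vec l (\<lambda>_. 1)"
    by (intro eq_vecI) auto
  then have "\<bar>\<Sum>j<l. x $ j\<bar> * \<psi> (vec l (\<lambda>_. 1)) \<le> real l * \<psi> x"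
    using sums[of l] by (simp add: scale)
  then show ?thesis using l by (simp add: field_simps)
qed

section \<open>Convex functions: Jensen's inequality and strict monotonicity\<close>

lemma convex_on_average:
  fixes f :: "real \<Rightarrow> real"
  assumes "convex_on {0..} f" and "\<And>i. i < l \<Longrightarrow> 0 \<le> a i" and l: "0 < l"
  shows "real l * f ((\<Sum>i<l. a i) / real l) \<le> (\<Sum>i<l. f (a i))"
proof -
  have "f (\<Sum>i<l. (1 / real l) *\<^sub>R a i) \<le> (\<Sum>i<l. (1 / real l) * f (a i))"
    using assms by (intro convex_on_sum[of "{..<l}" "{0..}"]) auto
  also have "(\<Sum>i<l. (1 / real l) *\<^sub>R a i) = (\<Sum>i<l. a i) / real l"
    by (simp add: sum_divide_distrib)
  also have "(\<Sum>i<l. (1 / real l) * f (a i)) = (\<Sum>i<l. f (a i)) / real l"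
    by (simp add: sum_divide_distrib)
  finally show ?thesis using l by (simp add: field_simps)
qed

lemma strictly_convex_onD:
  assumes "strictly_convex_on S f" "x \<in> S" "y \<in> S" "x \<noteq> y" "0 < u" "0 < v" "u + v = 1"
  shows "f (u * x + v * y) < u * f x + v * f y"
  using assms unfolding strictly_convex_on_def by blast

lemma strictly_convex_on_imp_convex_on:
  assumes "strictly_convex_on S f"
  shows "convex_on S f"
  unfolding convex_on_def
proof (intro conjI ballI allI impI)
  show "convex S" using assms by (simp add: strictly_convex_on_def)
  fix x y u v :: real
  assume h: "x \<in> S" "y \<in> S" "0 \<le> u" "0 \<le> v" "u + v = 1"
  show "f (u *\<^sub>R x + v *\<^sub>R y) \<le> u * f x + v * f y"
  proof (cases "u = 0 \<or> v = 0 \<or> x = y")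
    case True
    then show ?thesis using h by (auto simp: distrib_right[symmetric])
  next
    case False
    then have "f (u * x + v * y) < u * f x + v * f y"
      using h by (intro strictly_convex_onD[OF assms]) auto
    then show ?thesis by simp
  qed
qed

text \<open>The value at the midpoint is at least f x by monotonicity and less than the mean of f x
  and f y by strict convexity. It serves to turn equality in the trace inequality into a comparison
  of the arguments of f.\<close>

lemma mono_strictly_convex_imp_strict_mono:
  assumes m: "mono_on {0..} f" and c: "strictly_convex_on {0..} f" and x: "0 \<le> x" "x < y"
  shows "f x < f y"
proof -
  have "f (1/2 * x + 1/2 * y) < 1/2 * f x + 1/2 * f y"
    using x by (intro strictly_convex_onD[OF c]) auto
  moreover have "f x \<le> f (1/2 * x + 1/2 * y)"
    using x by (intro mono_onD[OF m]) auto
  ultimately show ?thesis by simp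
qed

section \<open>The trace of the square root\<close>

text \<open>Positivity is expressed by diagonal entries of conjugates instead of a quadratic form:
  for the diagonalizing unitary these entries are the eigenvalues themselves.\<close>

lemma positive_diagonalization:
  fixes A :: "complex mat"
  assumes A: "A \<in> carrier_mat n n" "mat_adjoint A = A"
    and pos: "\<And>U i. U \<in> carrier_mat n n \<Longrightarrow> i < n \<Longrightarrow> 0 \<le> Re ((mat_adjoint U * A * U) $$ (i, i))"
  obtains U a where "unitary_mat n U" "A = U * real_diag n a * mat_adjoint U" "\<And>i. i < n \<Longrightarrow> 0 \<le> a i"
proof -
  obtain U a where U: "unitary_mat n U" and AU: "A = U * real_diag n a * mat_adjoint U"
    using hermitian_diagonalization[OF A] by blast
  have Uc: "U \<in> carrier_mat n n" and Uu: "mat_adjoint U * U = 1\<^sub>m n"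
    using U by (auto simp: unitary_mat_def)
  have "mat_adjoint U * A * U = (mat_adjoint U * U) * real_diag n a * (mat_adjoint U * U)"
    using Uc by (simp add: AU mult_mat_assoc_dim)
  also have "\<dots> = real_diag n a"
    unfolding Uu by (simp add: left_mult_one_mat[of _ n n] right_mult_one_mat[of _ n n])
  finally have "0 \<le> a i" if "i < n" for i
    using pos[OF Uc that] that by (simp add: mat_diag_def)
  then show ?thesis using that U AU by blast
qed

lemma gram_form_nonneg:
  fixes V U :: "complex mat"
  assumes V: "V \<in> carrier_mat l d" and U: "U \<in> carrier_mat d e" and i: "i < e"
  shows "0 \<le> Re ((mat_adjoint U * (mat_adjoint V * V) * U) $$ (i, i))"
proof -
  have VU: "V * U \<in> carrier_mat l e" using V U by auto
  have "mat_adjoint U * (mat_adjoint V * V) * U = mat_adjoint (V * U) * (V * U)"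
    using V U by (simp add: mat_adjoint_mult[OF V U] mult_mat_assoc_dim)
  then show ?thesis
    using adjoint_mult_self_index[OF VU i] by (simp add: sum_nonneg)
qed

text \<open>\<open>1 - P\<close> is again a Hermitian idempotent, so n - tr P is its squared
  Frobenius norm: nonnegative, and zero only for \<open>P = 1\<close>.\<close>

lemma hermitian_idempotent_trace_le:
  fixes P :: "complex mat"
  assumes P: "P \<in> carrier_mat n n" and H: "mat_adjoint P = P" and I: "P * P = P"
  shows "Re (mat_trace P) \<le> real n"
    and "real n \<le> Re (mat_trace P) \<Longrightarrow> P = 1\<^sub>m n"
proof -
  let ?Q = "1\<^sub>m n - P"
  have Qc: "?Q \<in> carrier_mat n n" using P by auto
  have QH: "mat_adjoint ?Q = ?Q"
  proof (rule eq_matI)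
    fix i j assume "i < dim_row ?Q" "j < dim_col ?Q"
    then have ij: "i < n" "j < n" using P by auto
    then have "cnj (P $$ (j, i)) = P $$ (i, j)" using mat_adjoint_index[of i P j] H P by simp
    then show "mat_adjoint ?Q $$ (i, j) = ?Q $$ (i, j)" using ij P by auto
  qed (use P in auto)
  have "P * ?Q = P * 1\<^sub>m n - P * P"
    using P by (intro mult_minus_distrib_mat[of _ n n]) auto
  also have "\<dots> = 0\<^sub>m n n" using P I by simp
  finally have "P * ?Q = 0\<^sub>m n n" .
  moreover have "?Q * ?Q = 1\<^sub>m n * ?Q - P * ?Q"
    using P by (intro minus_mult_distrib_mat[of _ n n]) auto
  moreover have "?Q - 0\<^sub>m n n = ?Q" by (intro eq_matI) (use P in auto)
  ultimately have "?Q * ?Q = ?Q" using left_mult_one_mat[OF Qc] by simp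
  then have tr: "Re (mat_trace (mat_adjoint ?Q * ?Q)) = real n - Re (mat_trace P)"
    unfolding QH using P by (simp add: mat_trace_def sum_subtractf)
  then show "Re (mat_trace P) \<le> real n"
    using trace_adjoint_mult_self_nonneg[of ?Q] by simp
  assume "real n \<le> Re (mat_trace P)"
  then have "?Q = 0\<^sub>m n n"
    using tr by (intro trace_adjoint_mult_self_zero[OF Qc]) simp
  then have Q0: "?Q $$ (i, j) = 0\<^sub>m n n $$ (i, j)" for i j by simp
  have "P $$ (i, j) = 1\<^sub>m n $$ (i, j)" if "i < n" "j < n" for i j
    using Q0[of i j] that P by simp
  then show "P = 1\<^sub>m n" using P by (intro eq_matI) auto
qed

text \<open>If \<open>T\<close> is the partial isometry of the polar decomposition of \<open>V\<close>, both parts come from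
  expanding \<open>tr ((V - c T)\<^sup>* (V - c T)) \<ge> 0\<close>, where \<open>tr (T\<^sup>* V) = tr ((V\<^sup>* V)\<^sup>1\<^sup>/\<^sup>2)\<close> and
  \<open>tr (T\<^sup>* T) \<le> l\<close>.\<close>
lemma trace_sqrt_bound:
  fixes V :: "complex mat"
  assumes V: "V \<in> carrier_mat l d" and c: "0 < c"
    and tr: "c * real l \<le> Re (mat_trace (fun_calc sqrt (mat_adjoint V * V)))"
  shows "c\<^sup>2 * real l \<le> Re (mat_trace (mat_adjoint V * V))"
    and "Re (mat_trace (mat_adjoint V * V)) \<le> c\<^sup>2 * real l \<Longrightarrow>
      V * mat_adjoint V = complex_of_real (c\<^sup>2) \<cdot>\<^sub>m 1\<^sub>m l"
proof -
  let ?A = "mat_adjoint V * V"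
  have Ac: "?A \<in> carrier_mat d d" using V by auto
  have AH: "mat_adjoint ?A = ?A"
    using mat_adjoint_mult[OF mat_adjoint_carrier[OF V] V] by simp
  obtain U a where U: "unitary_mat d U" and AU: "?A = U * real_diag d a * mat_adjoint U"
    and a: "\<And>i. i < d \<Longrightarrow> 0 \<le> a i"
    using positive_diagonalization[OF Ac AH] gram_form_nonneg[OF V] by metis
  have Uc: "U \<in> carrier_mat d d" and Uu: "mat_adjoint U * U = 1\<^sub>m d" "U * mat_adjoint U = 1\<^sub>m d"
    using U by (auto simp: unitary_mat_def)
  have trA: "Re (mat_trace ?A) = (\<Sum>i<d. a i)"
    unfolding AU by (simp add: mat_trace_unitary_conj[OF U] mat_trace_real_diag)
  have trs: "c * real l \<le> (\<Sum>i<d. sqrt (a i))"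
    using tr trace_fun_calc_diagonalized[OF U AU] by simp
  define W where "W = V * U"
  have Wc: "W \<in> carrier_mat l d" using V Uc by (auto simp: W_def)
  have WW: "mat_adjoint W * W = real_diag d a"
  proof -
    have "mat_adjoint W * W = mat_adjoint U * ?A * U"
      using V Uc by (simp add: W_def mat_adjoint_mult[OF V Uc] mult_mat_assoc_dim)
    also have "\<dots> = (mat_adjoint U * U) * real_diag d a * (mat_adjoint U * U)"
      unfolding AU using Uc by (simp add: mult_mat_assoc_dim)
    finally show ?thesis
      unfolding Uu by (simp add: left_mult_one_mat[of _ d d] right_mult_one_mat[of _ d d])
  qed
  \<comment> \<open>\<open>g\<close> is the pseudo-inverse of the square root on the spectrum and
    \<open>h\<close> the indicator of its support. The partial isometry of the polar decomposition
    is then T = Y U^* with \<open>Y = W * real_diag d g\<close>; the argument works with W and Y,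
    the matrices V and T written in the eigenbasis.\<close>
  define g where "g i = (if a i = 0 then 0 else 1 / sqrt (a i))" for i
  define h where "h i = (if a i = 0 then 0 else 1 :: real)" for i
  define Y where "Y = W * real_diag d g"
  have Yc: "Y \<in> carrier_mat l d" using Wc by (auto simp: Y_def)
  have YY: "mat_adjoint Y * Y = real_diag d h"
  proof -
    have "mat_adjoint Y * Y = real_diag d g * (mat_adjoint W * W) * real_diag d g"
      using Wc by (simp add: Y_def mat_adjoint_mult[OF Wc mat_diag_dim] mult_mat_assoc_dim)
    also have "\<dots> = mat_diag d (\<lambda>i. complex_of_real (g i * a i * g i))"
      unfolding WW by simp
    also have "\<dots> = real_diag d h"
    proof (rule eq_matI)
      have "g i * a i * g i = h i" if "i < d" for i
        using a[OF that] by (simp add: g_def h_def)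
      then show "mat_diag d (\<lambda>i. complex_of_real (g i * a i * g i)) $$ (i, j) = real_diag d h $$ (i, j)"
        if "i < dim_row (real_diag d h)" "j < dim_col (real_diag d h)" for i j
        using that by (simp add: mat_diag_def del: of_real_mult)
    qed auto
    finally show ?thesis .
  qed
  have Yh: "Y * real_diag d h = Y"
  proof -
    have "g i * h i = g i" for i by (simp add: g_def h_def)
    then have "real_diag d g * real_diag d h = real_diag d g"
      unfolding mat_diag_diag by (simp only: of_real_mult[symmetric])
    then show ?thesis unfolding Y_def using Wc by (simp add: mult_mat_assoc_dim)
  qed
  \<comment> \<open>The number of nonzero \<open>a i\<close> is the trace of
    \<open>mat_adjoint Y * Y\<close>, hence also of P. Unlike the former, P has size l, and this is
    where the bound l enters.\<close>
  define P where "P = Y * mat_adjoint Y"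
  have Pc: "P \<in> carrier_mat l l" using Yc by (auto simp: P_def)
  have PH: "mat_adjoint P = P"
    using mat_adjoint_mult[OF Yc mat_adjoint_carrier[OF Yc]] by (simp add: P_def)
  have "P * P = Y * (mat_adjoint Y * Y) * mat_adjoint Y"
    using Yc by (simp add: P_def mult_mat_assoc_dim)
  then have PI: "P * P = P" unfolding YY Yh P_def .
  have trP: "Re (mat_trace P) = (\<Sum>i<d. h i)"
  proof -
    have "mat_trace P = mat_trace (mat_adjoint Y * Y)"
      unfolding P_def by (rule mat_trace_mult_comm[OF Yc mat_adjoint_carrier[OF Yc]])
    then show ?thesis by (simp add: YY mat_trace_real_diag)
  qed
  have hl: "(\<Sum>i<d. h i) \<le> real l"
    using hermitian_idempotent_trace_le(1)[OF Pc PH PI] trP by simp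
  \<comment> \<open>The left side is the squared Frobenius norm of V - c T, computed in the
    eigenbasis.\<close>
  have expand: "(\<Sum>i<d. (sqrt (a i) - c * h i)\<^sup>2)
      = (\<Sum>i<d. a i) - 2 * c * (\<Sum>i<d. sqrt (a i)) + c\<^sup>2 * (\<Sum>i<d. h i)"
  proof -
    have "(sqrt (a i) - c * h i)\<^sup>2 = a i - 2 * c * sqrt (a i) + c\<^sup>2 * h i" if "i < d" for i
      using a[OF that] by (simp add: h_def power2_diff)
    then have "(\<Sum>i<d. (sqrt (a i) - c * h i)\<^sup>2) = (\<Sum>i<d. a i - 2 * c * sqrt (a i) + c\<^sup>2 * h i)"
      by (intro sum.cong) auto
    then show ?thesis by (simp add: sum.distrib sum_subtractf sum_distrib_left)
  qed
  have nn: "0 \<le> (\<Sum>i<d. (sqrt (a i) - c * h i)\<^sup>2)" by (intro sum_nonneg) auto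
  have b1: "2 * c * (c * real l) \<le> 2 * c * (\<Sum>i<d. sqrt (a i))"
    using trs c by (intro mult_left_mono) auto
  have b2: "c\<^sup>2 * (\<Sum>i<d. h i) \<le> c\<^sup>2 * real l"
    using hl by (intro mult_left_mono) auto
  have b1': "2 * c * (c * real l) = 2 * (c\<^sup>2 * real l)" by (simp add: power2_eq_square)
  show "c\<^sup>2 * real l \<le> Re (mat_trace ?A)"
    using nn b1 b2 unfolding expand trA b1' by linarith
  \<comment> \<open>Now all the estimates are equalities: each square vanishes, and the
    \<open>h i\<close> sum to at least l, so P has full trace.\<close>
  assume "Re (mat_trace ?A) \<le> c\<^sup>2 * real l"
  then have "(\<Sum>i<d. (sqrt (a i) - c * h i)\<^sup>2) = 0" and "c\<^sup>2 * real l \<le> c\<^sup>2 * (\<Sum>i<d. h i)"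
    using nn b1 b2 unfolding expand trA b1' by linarith+
  then have ah: "\<And>i. i < d \<Longrightarrow> sqrt (a i) = c * h i" and "real l \<le> (\<Sum>i<d. h i)"
    using c by (auto simp: sum_nonneg_eq_0_iff mult_le_cancel_left)
  then have P1: "P = 1\<^sub>m l"
    using hermitian_idempotent_trace_le(2)[OF Pc PH PI] trP by simp
  \<comment> \<open>Where \<open>a i = 0\<close>, column i vanishes in W because its squared norm is
    \<open>a i\<close>, and in Y because \<open>g i = 0\<close>. In every other column
    \<open>sqrt (a i) = c\<close>.\<close>
  have WY: "W $$ (k, i) = complex_of_real c * Y $$ (k, i)" if ki: "k < l" "i < d" for k i
  proof (cases "a i = 0")
    case True
    have "(\<Sum>k<l. (cmod (W $$ (k, i)))\<^sup>2) = 0"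
      using adjoint_mult_self_index[OF Wc ki(2)] True ki unfolding WW
      by (simp add: mat_diag_def del: of_real_sum)
    then have "W $$ (k, i) = 0" using ki by (auto simp: sum_nonneg_eq_0_iff)
    moreover have "Y $$ (k, i) = 0"
      using True ki by (simp add: Y_def mat_diag_mult_right[OF Wc] g_def)
    ultimately show ?thesis by simp
  next
    case False
    then have "sqrt (a i) = c" using ah[OF ki(2)] by (simp add: h_def)
    then show ?thesis
      using ki False c by (simp add: Y_def mat_diag_mult_right[OF Wc] g_def)
  qed
  have "V * mat_adjoint V = W * mat_adjoint W"
  proof -
    have "W * mat_adjoint W = V * (U * mat_adjoint U) * mat_adjoint V"
      using V Uc by (simp add: W_def mat_adjoint_mult[OF V Uc] mult_mat_assoc_dim)
    then show ?thesis unfolding Uu using V by simp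
  qed
  also have "W = complex_of_real c \<cdot>\<^sub>m Y"
    using Wc Yc WY by (intro eq_matI) auto
  also have "complex_of_real c \<cdot>\<^sub>m Y * mat_adjoint (complex_of_real c \<cdot>\<^sub>m Y) = complex_of_real (c\<^sup>2) \<cdot>\<^sub>m P"
  proof -
    have "mat_adjoint (complex_of_real c \<cdot>\<^sub>m Y) = complex_of_real c \<cdot>\<^sub>m mat_adjoint Y"
      using Yc by (intro eq_matI) auto
    then have "complex_of_real c \<cdot>\<^sub>m Y * mat_adjoint (complex_of_real c \<cdot>\<^sub>m Y)
        = complex_of_real c \<cdot>\<^sub>m (complex_of_real c \<cdot>\<^sub>m P)"
      using Yc unfolding P_def
      by (simp add: mult_smult_assoc_mat[of _ l d _ l] mult_smult_distrib[of _ l d _ l])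
    also have "\<dots> = complex_of_real (c\<^sup>2) \<cdot>\<^sub>m P"
      by (intro eq_matI) (auto simp: power2_eq_square)
    finally show ?thesis .
  qed
  finally show "V * mat_adjoint V = complex_of_real (c\<^sup>2) \<cdot>\<^sub>m 1\<^sub>m l" unfolding P1 .
qed

section \<open>Singular values of a Hermitian matrix\<close>

lemma sing_vals_diagonalized:
  assumes U: "unitary_mat n U" and A: "A = U * real_diag n a * mat_adjoint U"
  shows "sing_vals A \<in> carrier_vec n" and "(\<Sum>i<n. sing_vals A $ i) = (\<Sum>i<n. \<bar>a i\<bar>)"
proof -
  have Uc: "U \<in> carrier_mat n n" and Uu: "mat_adjoint U * U = 1\<^sub>m n"
    using U by (auto simp: unitary_mat_def)
  have UD: "U * real_diag n a \<in> carrier_mat n n" using Uc by auto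
  have "mat_adjoint A = U * mat_adjoint (U * real_diag n a)"
    unfolding A using mat_adjoint_mult[OF UD mat_adjoint_carrier[OF Uc]] by simp
  also have "\<dots> = A"
    unfolding A using mat_adjoint_mult[OF Uc mat_diag_dim] Uc by (simp add: mult_mat_assoc_dim)
  finally have "mat_adjoint A = A" .
  then have "mat_adjoint A * A = U * real_diag n a * (mat_adjoint U * U) * real_diag n a * mat_adjoint U"
    using Uc by (simp add: A mult_mat_assoc_dim)
  also have "\<dots> = U * (real_diag n a * real_diag n a) * mat_adjoint U"
    unfolding Uu using Uc by (simp add: mult_mat_assoc_dim left_mult_one_mat[of _ n n])
  also have "\<dots> = U * real_diag n (\<lambda>i. a i * a i) * mat_adjoint U" by simp
  finally have e: "eigvals_decr (mat_adjoint A * A) = vec_of_list (rev (sort (map (\<lambda>i. a i * a i) [0..<n])))"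
    by (rule eigvals_decr_diagonalized[OF U])
  let ?ys = "rev (sort (map (\<lambda>i. a i * a i) [0..<n]))"
  have s: "sing_vals A = map_vec sqrt (vec_of_list ?ys)" unfolding sing_vals_def e ..
  show "sing_vals A \<in> carrier_vec n" unfolding s by (intro carrier_vecI) simp
  have "(\<Sum>i<n. sing_vals A $ i) = sum_list (map sqrt ?ys)"
    unfolding s using sum_vec_of_list[of "map sqrt ?ys"]
    by (simp add: vec_of_list_index)
  also have "\<dots> = sum_list (map sqrt (map (\<lambda>i. a i * a i) [0..<n]))"
    by (simp only: sum_mset_sum_list[symmetric] mset_map mset_rev mset_sort)
  also have "\<dots> = (\<Sum>i<n. \<bar>a i\<bar>)"
    by (simp add: o_def interv_sum_list_conv_sum_set_nat atLeast0LessThan)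
  finally show "(\<Sum>i<n. sing_vals A $ i) = (\<Sum>i<n. \<bar>a i\<bar>)" .
qed

section \<open>Reconstruction systems\<close>

lemma matrix_sum_carrier [simp]: "matrix_sum r c I A \<in> carrier_mat r c"
  by (simp add: matrix_sum_def)

lemma matrix_sum_dim [simp]: "dim_row (matrix_sum r c I A) = r" "dim_col (matrix_sum r c I A) = c"
  by (simp_all add: matrix_sum_def)

lemma matrix_sum_index [simp]:
  "i < r \<Longrightarrow> j < c \<Longrightarrow> matrix_sum r c I A $$ (i, j) = (\<Sum>k\<in>I. A k $$ (i, j))"
  by (simp add: matrix_sum_def)

lemma mat_trace_matrix_sum:
  assumes "\<And>k. k \<in> I \<Longrightarrow> A k \<in> carrier_mat n n"
  shows "mat_trace (matrix_sum n n I A) = (\<Sum>k\<in>I. mat_trace (A k))"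
proof -
  have "(\<Sum>k\<in>I. mat_trace (A k)) = (\<Sum>k\<in>I. \<Sum>i<n. A k $$ (i, i))"
    using assms by (intro sum.cong) (auto simp: mat_trace_def)
  then show ?thesis by (simp add: mat_trace_def sum.swap[of _ I])
qed

lemma mat_adjoint_matrix_sum:
  assumes "\<And>k. k \<in> I \<Longrightarrow> A k \<in> carrier_mat n n" "\<And>k. k \<in> I \<Longrightarrow> mat_adjoint (A k) = A k"
  shows "mat_adjoint (matrix_sum n n I A) = matrix_sum n n I A"
proof (rule eq_matI)
  fix i j assume "i < dim_row (matrix_sum n n I A)" "j < dim_col (matrix_sum n n I A)"
  then have ij: "i < n" "j < n" by auto
  have "cnj (A k $$ (j, i)) = A k $$ (i, j)" if "k \<in> I" for k
    using mat_adjoint_index[of i "A k" j] assms[OF that] ij by simp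
  then show "mat_adjoint (matrix_sum n n I A) $$ (i, j) = matrix_sum n n I A $$ (i, j)"
    using ij by simp
qed auto

lemma conj_index:
  fixes U A :: "complex mat"
  assumes U: "U \<in> carrier_mat n e" and A: "A \<in> carrier_mat n n" and i: "i < e"
  shows "(mat_adjoint U * A * U) $$ (i, i) = (\<Sum>b<n. \<Sum>a<n. cnj (U $$ (a, i)) * A $$ (a, b) * U $$ (b, i))"
proof -
  have UA: "mat_adjoint U * A \<in> carrier_mat e n" using U A by auto
  have "(mat_adjoint U * A) $$ (i, b) = (\<Sum>a<n. cnj (U $$ (a, i)) * A $$ (a, b))" if "b < n" for b
    using mult_mat_index[OF mat_adjoint_carrier[OF U] A i that] U i by simp
  then show ?thesis
    using mult_mat_index[OF UA U i i] by (simp add: sum_distrib_right)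
qed

text \<open>Linearity of a diagonal entry of the conjugate, which carries nonnegativity from the
  summands of the q-potential to their sum.\<close>

lemma conj_matrix_sum_index:
  fixes U :: "complex mat"
  assumes U: "U \<in> carrier_mat n e" and A: "\<And>k. k \<in> I \<Longrightarrow> A k \<in> carrier_mat n n" and i: "i < e"
  shows "(mat_adjoint U * matrix_sum n n I A * U) $$ (i, i) = (\<Sum>k\<in>I. (mat_adjoint U * A k * U) $$ (i, i))"
proof -
  have "(\<Sum>k\<in>I. (mat_adjoint U * A k * U) $$ (i, i))
      = (\<Sum>k\<in>I. \<Sum>b<n. \<Sum>a<n. cnj (U $$ (a, i)) * A k $$ (a, b) * U $$ (b, i))"
    using conj_index[OF U A i] by (intro sum.cong) auto
  also have "\<dots> = (\<Sum>b<n. \<Sum>a<n. \<Sum>k\<in>I. cnj (U $$ (a, i)) * A k $$ (a, b) * U $$ (b, i))"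
    by (simp add: sum.swap[of _ I])
  also have "\<dots> = (mat_adjoint U * matrix_sum n n I A * U) $$ (i, i)"
    using conj_index[OF U matrix_sum_carrier[of n n I A] i] by (simp add: sum_distrib_left sum_distrib_right)
  finally show ?thesis by simp
qed

lemma gram_carrier:
  "B \<in> carrier_mat r n \<Longrightarrow> mat_adjoint B * B \<in> carrier_mat n n"
  by (intro mult_carrier_mat[of _ n r]) auto

lemma gram_hermitian:
  fixes B :: "complex mat"
  assumes "B \<in> carrier_mat r n"
  shows "mat_adjoint (mat_adjoint B * B) = mat_adjoint B * B"
  using mat_adjoint_mult[OF mat_adjoint_carrier[OF assms] assms] by simp

lemma frame_op_hermitian:
  assumes "\<And>i. i \<in> {1..m} \<Longrightarrow> V i \<in> carrier_mat l d"
  shows "mat_adjoint (frame_op m d V) = frame_op m d V"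
  unfolding frame_op_def
  by (intro mat_adjoint_matrix_sum gram_hermitian[OF assms] gram_carrier[OF assms])

lemma frame_op_carrier [simp]: "frame_op m d V \<in> carrier_mat d d"
  by (simp add: frame_op_def)

section \<open>Spectrum and trace of the q-potential\<close>

text \<open>Every summand is a Gram matrix, so conjugates of the sum have nonnegative diagonals.
  Nonnegative eigenvalues permit Jensen's inequality on \<open>{0..}\<close> and make the sum of the
  singular values equal to the trace.\<close>

lemma q_potential_diagonalization:
  assumes V: "\<And>i. i \<in> {1..m} \<Longrightarrow> V i \<in> carrier_mat l d"
  obtains U a where "unitary_mat l U" "q_potential m l V = U * real_diag l a * mat_adjoint U"
    "\<And>i. i < l \<Longrightarrow> 0 \<le> a i"
proof -
  let ?B = "\<lambda>(i, j). V i * mat_adjoint (V j)"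
  have q: "q_potential m l V = matrix_sum l l ({1..m} \<times> {1..m}) (\<lambda>k. mat_adjoint (?B k) * ?B k)"
    unfolding q_potential_def abs_sq_def by (simp add: case_prod_unfold)
  have B: "?B k \<in> carrier_mat l l" if "k \<in> {1..m} \<times> {1..m}" for k
    using that mult_carrier_mat[OF V mat_adjoint_carrier[OF V]] by auto
  then have BB: "mat_adjoint (?B k) * ?B k \<in> carrier_mat l l" if "k \<in> {1..m} \<times> {1..m}" for k
    using that gram_carrier by blast
  show ?thesis
  proof (rule positive_diagonalization[of "q_potential m l V" l])
    show "q_potential m l V \<in> carrier_mat l l" by (simp add: q)
    show "mat_adjoint (q_potential m l V) = q_potential m l V"
      unfolding q by (intro mat_adjoint_matrix_sum gram_hermitian[OF B] BB)
    show "0 \<le> Re ((mat_adjoint U * q_potential m l V * U) $$ (i, i))"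
      if "U \<in> carrier_mat l l" "i < l" for U i
    proof -
      have "(mat_adjoint U * q_potential m l V * U) $$ (i, i)
        = (\<Sum>k\<in>{1..m} \<times> {1..m}. (mat_adjoint U * (mat_adjoint (?B k) * ?B k) * U) $$ (i, i))"
        unfolding q by (rule conj_matrix_sum_index[OF that(1) BB that(2)])
      moreover have "0 \<le> Re ((mat_adjoint U * (mat_adjoint (?B k) * ?B k) * U) $$ (i, i))"
        if "k \<in> {1..m} \<times> {1..m}" for k
        using gram_form_nonneg[OF B[OF that]] \<open>U \<in> carrier_mat l l\<close> \<open>i < l\<close> by blast
      ultimately show ?thesis by (simp only: Re_sum) (intro sum_nonneg)
    qed
  qed (use that in blast)
qed

lemma mat_trace_mult:
  assumes "A \<in> carrier_mat n n" "B \<in> carrier_mat n n"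
  shows "mat_trace (A * B) = (\<Sum>a<n. \<Sum>b<n. A $$ (a, b) * B $$ (b, a))"
  using assms mult_mat_index[OF assms] by (auto simp: mat_trace_def intro!: sum.cong)

text \<open>With M_i = V_i^* V_i, the summand is V_j M_i V_j^* and has trace tr (M_i M_j) by
  cyclicity; the double sum over i and j is then the trace of the square of the frame
  operator.\<close>

lemma trace_q_potential:
  assumes V: "\<And>i. i \<in> {1..m} \<Longrightarrow> V i \<in> carrier_mat l d"
  shows "mat_trace (q_potential m l V) = mat_trace (frame_op m d V * frame_op m d V)"
proof -
  define M where "M i = mat_adjoint (V i) * V i" for i
  have M: "M i \<in> carrier_mat d d" if "i \<in> {1..m}" for i
    using V[OF that] by (auto simp: M_def)
  have one: "mat_trace (abs_sq (V i * mat_adjoint (V j))) = mat_trace (M i * M j)"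
    if "i \<in> {1..m}" "j \<in> {1..m}" for i j
  proof -
    note c = V[OF that(1)] V[OF that(2)]
    have "abs_sq (V i * mat_adjoint (V j)) = V j * (M i * mat_adjoint (V j))"
      using c unfolding abs_sq_def M_def
      by (simp add: mat_adjoint_mult[OF c(1) mat_adjoint_carrier[OF c(2)]] mult_mat_assoc_dim)
    also have "mat_trace \<dots> = mat_trace (M i * mat_adjoint (V j) * V j)"
      using c M[OF that(1)] by (intro mat_trace_mult_comm[of _ l d]) auto
    also have "M i * mat_adjoint (V j) * V j = M i * M j"
      using c M[OF that(1)] unfolding M_def[of j] by (simp add: mult_mat_assoc_dim)
    finally show ?thesis .
  qed
  have "mat_trace (q_potential m l V) = (\<Sum>(i, j)\<in>{1..m} \<times> {1..m}. mat_trace (abs_sq (V i * mat_adjoint (V j))))"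
    unfolding q_potential_def
    using gram_carrier[OF mult_carrier_mat[OF V mat_adjoint_carrier[OF V]]]
    by (subst mat_trace_matrix_sum) (auto simp: abs_sq_def case_prod_unfold)
  also have "\<dots> = (\<Sum>i\<in>{1..m}. \<Sum>j\<in>{1..m}. mat_trace (abs_sq (V i * mat_adjoint (V j))))"
    by (simp add: sum.cartesian_product)
  also have "\<dots> = (\<Sum>i\<in>{1..m}. \<Sum>j\<in>{1..m}. \<Sum>a<d. \<Sum>b<d. M i $$ (a, b) * M j $$ (b, a))"
    by (intro sum.cong refl) (simp only: one mat_trace_mult[OF M M])
  also have "\<dots> = (\<Sum>a<d. \<Sum>b<d. \<Sum>i\<in>{1..m}. \<Sum>j\<in>{1..m}. M i $$ (a, b) * M j $$ (b, a))"
    by (simp only: sum.swap[of _ "{..<d}" "{1..m}"])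
  also have "\<dots> = mat_trace (frame_op m d V * frame_op m d V)"
    unfolding mat_trace_mult[OF frame_op_carrier frame_op_carrier]
    by (simp add: frame_op_def M_def sum_product)
  finally show ?thesis .
qed

text \<open>If l or m were 0, the frame operator would be zero and not invertible in dimension d >
  0. This gives the quotients by l and m their usual meaning.\<close>

lemma reconstruction_system_pos:
  assumes rs: "reconstruction_system F m l d V" and d: "0 < d"
  shows "0 < l" "0 < m"
proof -
  let ?S = "frame_op m d V"
  have V: "V i \<in> carrier_mat l d" if "i \<in> {1..m}" for i
    using rs that by (auto simp: reconstruction_system_def mats_over_def)
  have "?S \<noteq> 0\<^sub>m d d"
  proof
    assume z: "?S = 0\<^sub>m d d"
    obtain B where B: "inverts_mat ?S B" "inverts_mat B ?S"
      using rs by (auto simp: reconstruction_system_def invertible_mat_def)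
    \<comment> \<open>\<open>inverts_mat\<close> does not fix the shape of B; comparing column
      counts in the two identities does.\<close>
    have "dim_row B = d" using arg_cong[OF B(2)[unfolded inverts_mat_def z], of dim_col] by simp
    moreover have "dim_col B = d" using arg_cong[OF B(1)[unfolded inverts_mat_def z], of dim_col] by simp
    ultimately have "B \<in> carrier_mat d d" by auto
    then have "0\<^sub>m d d = (1\<^sub>m d :: complex mat)" using B(1) unfolding inverts_mat_def z by simp
    from arg_cong[OF this, of "\<lambda>M. M $$ (0, 0)"] show False using d by simp
  qed
  moreover have "?S = 0\<^sub>m d d" if "l = 0 \<or> m = 0"
  proof (rule eq_matI)
    fix a b assume "a < dim_row (0\<^sub>m d d :: complex mat)" "b < dim_col (0\<^sub>m d d :: complex mat)"
    then have ab: "a < d" "b < d" by auto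
    have "(mat_adjoint (V i) * V i) $$ (a, b) = 0" if "i \<in> {1..m}" for i
      using mult_mat_index[OF mat_adjoint_carrier[OF V[OF that]] V[OF that] ab]
        \<open>l = 0 \<or> m = 0\<close> that by auto
    then show "?S $$ (a, b) = 0\<^sub>m d d $$ (a, b)" using ab by (simp add: frame_op_def)
  qed (simp_all add: frame_op_def)
  ultimately have "\<not> (l = 0 \<or> m = 0)" by blast
  then show "0 < l" "0 < m" by auto
qed

text \<open>The adjoint is injective because V followed after it is multiplication by
  \<open>w \<noteq> 0\<close>; so its columns are independent.\<close>

lemma rank_adjoint_of_scaled_coisometry:
  fixes V :: "complex mat"
  assumes V: "V \<in> carrier_mat l d" and VV: "V * mat_adjoint V = w \<cdot>\<^sub>m 1\<^sub>m l" and w: "w \<noteq> 0"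
  shows "vec_space.rank d (mat_adjoint V) = l"
proof -
  let ?A = "mat_adjoint V"
  have A: "?A \<in> carrier_mat d l" using V by simp
  interpret vec_space "TYPE(complex)" d .
  have kernel: "v = 0\<^sub>v l" if v: "v \<in> carrier_vec l" "?A *\<^sub>v v = 0\<^sub>v d" for v
  proof -
    have "w \<cdot>\<^sub>v v = V *\<^sub>v (?A *\<^sub>v v)"
      using V A v(1) VV by (simp add: assoc_mult_mat_vec[symmetric, of _ l d _ l])
        (intro eq_vecI; auto)
    also have "\<dots> = 0\<^sub>v l" using V v(2) by (intro eq_vecI) auto
    finally have e: "w \<cdot>\<^sub>v v = 0\<^sub>v l" .
    have "v $ i = 0" if "i < l" for i
      using arg_cong[OF e, of "\<lambda>u. u $ i"] that v(1) w by simp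
    then show ?thesis using v(1) by (intro eq_vecI) auto
  qed
  \<comment> \<open>Independence speaks of the set of columns, so repeated columns are excluded
    separately: they would equate a diagonal and an off-diagonal entry of
    \<open>w \<cdot>\<^sub>m 1\<^sub>m l\<close>.\<close>
  have distinct: "distinct (cols ?A)"
  proof (subst distinct_conv_nth, intro allI impI notI)
    fix i j assume ij: "i < length (cols ?A)" "j < length (cols ?A)" "i \<noteq> j"
      and eq: "cols ?A ! i = cols ?A ! j"
    then have i: "i < l" "j < l" using V by auto
    then have c: "col ?A i = col ?A j" using eq A cols_nth[of i ?A] cols_nth[of j ?A] V by simp
    have "(V * ?A) $$ (i, i) = (V * ?A) $$ (i, j)"
      using i V c by simp
    then show False using VV i ij(3) w by simp
  qed
  show ?thesis
  proof (rule lin_indpt_full_rank[OF A distinct])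
    show "lin_indpt (set (cols ?A))"
      using kernel lin_depE[OF A _ distinct] by metis
  qed
qed

section \<open>The lower bound on the trace of the q-potential and its equality case\<close>

lemma mat_trace_minus:
  assumes "A \<in> carrier_mat n n" "B \<in> carrier_mat n n"
  shows "mat_trace (A - B) = mat_trace A - mat_trace B"
  using assms by (simp add: mat_trace_def sum_subtractf)

lemma trace_square_minus_one:
  fixes S :: "complex mat"
  assumes S: "S \<in> carrier_mat n n" and H: "mat_adjoint S = S"
  shows "Re (mat_trace (mat_adjoint (S - 1\<^sub>m n) * (S - 1\<^sub>m n)))
    = Re (mat_trace (S * S)) - 2 * Re (mat_trace S) + real n"
proof -
  let ?Q = "S - 1\<^sub>m n"
  have Qc: "?Q \<in> carrier_mat n n" by auto
  have QH: "mat_adjoint ?Q = ?Q"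
  proof (rule eq_matI)
    fix i j assume "i < dim_row ?Q" "j < dim_col ?Q"
    then have ij: "i < n" "j < n" by auto
    then have "cnj (S $$ (j, i)) = S $$ (i, j)" using mat_adjoint_index[of i S j] H S by simp
    then show "mat_adjoint ?Q $$ (i, j) = ?Q $$ (i, j)" using ij S by auto
  qed auto
  have "?Q * ?Q = S * ?Q - 1\<^sub>m n * ?Q"
    using S by (intro minus_mult_distrib_mat[of _ n n]) auto
  also have "S * ?Q = S * S - S * 1\<^sub>m n"
    using S by (intro mult_minus_distrib_mat[of _ n n]) auto
  also have "\<dots> = S * S - S" using S by simp
  also have "1\<^sub>m n * ?Q = ?Q" using left_mult_one_mat[OF Qc] .
  finally have "?Q * ?Q = (S * S - S) - ?Q" .
  then have "mat_trace (?Q * ?Q) = mat_trace (S * S - S) - mat_trace ?Q"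
    using mat_trace_minus[OF minus_carrier_mat[OF S] Qc] by simp
  also have "\<dots> = mat_trace (S * S) - mat_trace S - (mat_trace S - mat_trace (1\<^sub>m n))"
    using mat_trace_minus[OF mult_carrier_mat[OF S S] S] mat_trace_minus[OF S one_carrier_mat] by simp
  finally have "mat_trace (?Q * ?Q) = mat_trace (S * S) - mat_trace S - (mat_trace S - mat_trace (1\<^sub>m n))" .
  then show ?thesis unfolding QH by (simp add: mat_trace_def[of "1\<^sub>m n"])
qed

lemma trace_q_potential_bound:
  assumes V: "\<And>i. i \<in> {1..m} \<Longrightarrow> V i \<in> carrier_mat l d" and pos: "0 < l" "0 < m" "0 < d"
    and tr: "\<And>i. i \<in> {1..m} \<Longrightarrow>
      sqrt (real d * real l / real m) \<le> Re (mat_trace (fun_calc sqrt (mat_adjoint (V i) * V i)))"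
  shows "real d \<le> Re (mat_trace (q_potential m l V))"
    and "Re (mat_trace (q_potential m l V)) \<le> real d \<Longrightarrow> frame_op m d V = 1\<^sub>m d"
    and "Re (mat_trace (q_potential m l V)) \<le> real d \<Longrightarrow> i \<in> {1..m} \<Longrightarrow>
      V i * mat_adjoint (V i) = complex_of_real (real d / (real l * real m)) \<cdot>\<^sub>m 1\<^sub>m l"
proof -
  let ?S = "frame_op m d V"
  let ?T = "\<lambda>i. Re (mat_trace (mat_adjoint (V i) * V i))"
  \<comment> \<open>Chosen so that c l is the assumed bound on the trace of the square root; then
    c^2 l = d / m is the share of each operator in tr S.\<close>
  define c where "c = sqrt (real d / (real l * real m))"
  have c: "0 < c" using pos by (simp add: c_def)
  have c2: "c\<^sup>2 = real d / (real l * real m)" by (simp add: c_def)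
  have cl: "c * real l = sqrt (real d * real l / real m)"
  proof -
    have "c * real l = sqrt (real d / (real l * real m)) * sqrt ((real l)\<^sup>2)" by (simp add: c_def)
    also have "\<dots> = sqrt (real d / (real l * real m) * (real l)\<^sup>2)" by (simp only: real_sqrt_mult)
    also have "real d / (real l * real m) * (real l)\<^sup>2 = real d * real l / real m"
      using pos by (simp add: power2_eq_square)
    finally show ?thesis .
  qed
  have c2l: "c\<^sup>2 * real l = real d / real m" using pos by (simp add: c2)
  have tr': "c * real l \<le> Re (mat_trace (fun_calc sqrt (mat_adjoint (V i) * V i)))" if "i \<in> {1..m}" for i
    using tr[OF that] cl by simp
  have Ti: "real d / real m \<le> ?T i" if "i \<in> {1..m}" for i
    using trace_sqrt_bound(1)[OF V[OF that] c tr'[OF that]] c2l by simp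
  have trS: "Re (mat_trace ?S) = (\<Sum>i\<in>{1..m}. ?T i)"
    unfolding frame_op_def by (subst mat_trace_matrix_sum) (auto intro!: gram_carrier V)
  have "(\<Sum>i\<in>{1..m}. real d / real m) \<le> (\<Sum>i\<in>{1..m}. ?T i)"
    by (intro sum_mono Ti)
  then have dS: "real d \<le> Re (mat_trace ?S)" using pos by (simp add: trS)
  have sq: "Re (mat_trace (mat_adjoint (?S - 1\<^sub>m d) * (?S - 1\<^sub>m d)))
      = Re (mat_trace (q_potential m l V)) - 2 * Re (mat_trace ?S) + real d"
    using trace_square_minus_one[OF frame_op_carrier frame_op_hermitian[OF V]] trace_q_potential[OF V]
    by simp
  \<comment> \<open>With tr S \<ge> d, the right side of \<open>sq\<close> is at most tr P_q(V) - d.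
    This gives the bound, and in the equality case it forces \<open>S - 1\<close> to vanish.\<close>
  have nn: "0 \<le> Re (mat_trace (mat_adjoint (?S - 1\<^sub>m d) * (?S - 1\<^sub>m d)))"
    by (rule trace_adjoint_mult_self_nonneg)
  show "real d \<le> Re (mat_trace (q_potential m l V))"
    using sq nn dS by linarith
  assume le: "Re (mat_trace (q_potential m l V)) \<le> real d"
  have "?S - 1\<^sub>m d \<in> carrier_mat d d" by auto
  then have Q0: "?S - 1\<^sub>m d = 0\<^sub>m d d"
    using sq le dS by (intro trace_adjoint_mult_self_zero) auto
  have entry: "(?S - 1\<^sub>m d) $$ (i, j) = 0\<^sub>m d d $$ (i, j)" for i j by (simp only: Q0)
  have "?S $$ (i, j) = 1\<^sub>m d $$ (i, j)" if "i < d" "j < d" for i j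
    using entry[of i j] that by simp
  then show S1: "?S = 1\<^sub>m d" using carrier_matD[OF frame_op_carrier[of m d V]] by (intro eq_matI) auto
  assume i: "i \<in> {1..m}"
  \<comment> \<open>Since tr S = d, the nonnegative excesses over d / m add up to zero, so each
    operator attains its own bound.\<close>
  have "(\<Sum>i\<in>{1..m}. ?T i - real d / real m) = 0"
    using trS pos unfolding S1 by (simp add: sum_subtractf mat_trace_def)
  then have "?T i - real d / real m = 0"
    using i Ti by (subst (asm) sum_nonneg_eq_0_iff) auto
  then show "V i * mat_adjoint (V i) = complex_of_real (real d / (real l * real m)) \<cdot>\<^sub>m 1\<^sub>m l"
    using trace_sqrt_bound(2)[OF V[OF i] c tr'[OF i]] c2l c2 by simp
qed

text \<open>Idempotence up to scale comes from M M = V^* (V V^* ) V = w M for M = V^* V. The case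
  distinction on F only ensures that the entries stay in F.\<close>

lemma orth_projection_of_scaled_coisometry:
  fixes V :: "complex mat"
  assumes F: "F = \<real> \<or> F = UNIV" and V: "V \<in> mats_over F l d"
    and VV: "V * mat_adjoint V = complex_of_real w \<cdot>\<^sub>m 1\<^sub>m l" and w: "0 < w"
  shows "orth_projection F d (complex_of_real (1 / w) \<cdot>\<^sub>m (mat_adjoint V * V))"
proof -
  let ?c = "complex_of_real (1 / w)"
  let ?M = "mat_adjoint V * V"
  have Vc: "V \<in> carrier_mat l d" using V by (simp add: mats_over_def)
  note Mc = gram_carrier[OF Vc]
  have VF: "V $$ (a, b) \<in> F" if "a < l" "b < d" for a b
    using V that elements_matI[OF Vc that refl] by (auto simp: mats_over_def)
  have entry: "(?c \<cdot>\<^sub>m ?M) $$ (a, b) \<in> F" if "a < d" "b < d" for a b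
  proof (cases "F = UNIV")
    case False
    then have R: "F = \<real>" using F by simp
    have "?M $$ (a, b) = (\<Sum>k<l. cnj (V $$ (k, a)) * V $$ (k, b))"
      using mult_mat_index[OF mat_adjoint_carrier[OF Vc] Vc that] Vc that by simp
    also have "\<dots> \<in> \<real>"
      using VF that unfolding R by (intro sum_in_Reals Reals_mult) (auto simp: Reals_cnj_iff)
    finally have "?c * ?M $$ (a, b) \<in> \<real>" by (intro Reals_mult Reals_of_real)
    then show ?thesis using R Vc that by (simp del: index_mult_mat(1))
  qed simp
  have "?M * ?M = mat_adjoint V * (V * mat_adjoint V) * V"
    using Vc by (simp add: mult_mat_assoc_dim)
  also have "\<dots> = complex_of_real w \<cdot>\<^sub>m ?M"
    unfolding VV using Vc
    by (simp add: mult_smult_distrib[of _ d l _ l] mult_smult_assoc_mat[of _ d l _ d])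
  finally have MM: "?M * ?M = complex_of_real w \<cdot>\<^sub>m ?M" .
  have "(?c \<cdot>\<^sub>m ?M) * (?c \<cdot>\<^sub>m ?M) = ?c \<cdot>\<^sub>m (?c \<cdot>\<^sub>m (?M * ?M))"
    using Mc by (simp add: mult_smult_distrib[of _ d d _ d] mult_smult_assoc_mat[of _ d d _ d])
  also have "\<dots> = ?c \<cdot>\<^sub>m ?M"
    unfolding MM using w Vc by (intro eq_matI) (auto simp del: index_mult_mat(1))
  finally have idem: "(?c \<cdot>\<^sub>m ?M) * (?c \<cdot>\<^sub>m ?M) = ?c \<cdot>\<^sub>m ?M" .
  have "mat_adjoint (?c \<cdot>\<^sub>m ?M) = ?c \<cdot>\<^sub>m mat_adjoint ?M"
    using Vc by (intro eq_matI) (auto simp del: index_mult_mat(1))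
  then have "mat_adjoint (?c \<cdot>\<^sub>m ?M) = ?c \<cdot>\<^sub>m ?M" using gram_hermitian[OF Vc] by simp
  moreover have "?c \<cdot>\<^sub>m ?M \<in> mats_over F d d"
    using Mc entry unfolding mats_over_def elements_mat_def by auto
  ultimately show ?thesis using idem by (simp add: orth_projection_def)
qed

theorem theorem3p4:
  fixes F :: "complex set" and m l d :: nat and V :: "nat \<Rightarrow> complex mat"
  assumes F: "F = \<real> \<or> F = UNIV"
    and ld: "l < d"
    and rs: "reconstruction_system F m l d V"
    and tr: "\<forall>i\<in>{1..m}.
      Re (mat_trace (fun_calc sqrt (mat_adjoint (V i) * V i))) \<ge> sqrt (real d * real l / real m)"
  shows "mat_submajorized (complex_of_real (real d / real l) \<cdot>\<^sub>m 1\<^sub>m l) (q_potential m l V)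
    \<and> (\<forall>N \<psi>. unitarily_invariant_norm l N \<and> assoc_gauge l N \<psi> \<longrightarrow>
          real d * eta \<psi> l \<le> N (q_potential m l V))
    \<and> (\<forall>f. mono_on {0..} f \<and> convex_on {0..} f \<and> f 0 = 0 \<longrightarrow>
          real l * f (real d / real l) \<le> Re (mat_trace (fun_calc f (q_potential m l V))))
    \<and> ((mat_majorized (complex_of_real (real d / real l) \<cdot>\<^sub>m 1\<^sub>m l) (q_potential m l V)
        \<or> (\<exists>N \<psi>. unitarily_invariant_norm l N \<and> assoc_gauge l N \<psi> \<and>
              real d * eta \<psi> l = N (q_potential m l V))
        \<or> (\<exists>f. mono_on {0..} f \<and> strictly_convex_on {0..} f \<and> f 0 = 0 \<and>
              real l * f (real d / real l) = Re (mat_trace (fun_calc f (q_potential m l V)))))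
      \<longleftrightarrow> uwp_protocol F m l d V \<and> full_rank_system m l d V)"
proof -
  let ?q = "q_potential m l V"
  have VF: "V i \<in> mats_over F l d" if "i \<in> {1..m}" for i
    using rs that by (simp add: reconstruction_system_def)
  then have V: "V i \<in> carrier_mat l d" if "i \<in> {1..m}" for i
    using that by (simp add: mats_over_def)
  have d: "0 < d" using ld by simp
  note l = reconstruction_system_pos(1)[OF rs d] and m = reconstruction_system_pos(2)[OF rs d]
  obtain U a where U: "unitary_mat l U" and q: "?q = U * real_diag l a * mat_adjoint U"
    and a: "\<And>i. i < l \<Longrightarrow> 0 \<le> a i"
    using q_potential_diagonalization[where m = m and V = V, OF V] by blast
  define T where "T = (\<Sum>i<l. a i)"
  have T: "Re (mat_trace ?q) = T"
    unfolding q T_def by (simp add: mat_trace_unitary_conj[OF U] mat_trace_real_diag)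
  note bound = trace_q_potential_bound[where m = m and V = V, OF V l m d bspec[OF tr], unfolded T]
  have dT: "real d \<le> T" by (rule bound(1))
  have ld': "real l * (real d / real l) = real d" using l by simp
  have avg: "real d / real l \<le> T / real l" using dT l by (simp add: divide_right_mono)
  note maj = mat_majorized_scalar_iff[OF U q, of "real d / real l", unfolded ld' T_def[symmetric], OF dT]

  \<comment> \<open>Stated with the true average T / l; replacing it by d / l already here would
    lose the comparison of T with d that the equality case needs.\<close>
  have norm_ge: "T / real l * \<psi> (vec l (\<lambda>_. 1)) \<le> N ?q" if "assoc_gauge l N \<psi>" for N \<psi>
  proof -
    have "(\<Sum>i<l. \<bar>a i\<bar>) = T" unfolding T_def using a by (intro sum.cong) auto
    moreover have "N ?q = \<psi> (sing_vals ?q)"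
      using that matrix_sum_carrier unfolding assoc_gauge_def q_potential_def by blast
    ultimately show ?thesis
      using symmetric_gauge_ge_average[OF _ sing_vals_diagonalized(1)[OF U q] l, of \<psi>]
        sing_vals_diagonalized(2)[OF U q] that dT by (simp add: assoc_gauge_def)
  qed
  \<comment> \<open>Strict positivity allows this factor to be cancelled when equality holds in the
    norm inequality.\<close>
  have gauge_pos: "0 < \<psi> (vec l (\<lambda>_. 1))" if "assoc_gauge l N \<psi>" for N \<psi>
  proof -
    have "vec l (\<lambda>_. 1 :: real) $ 0 \<noteq> 0\<^sub>v l $ 0" using l by simp
    then have "vec l (\<lambda>_. 1 :: real) \<noteq> 0\<^sub>v l" by metis
    moreover have "0 \<le> \<psi> x \<and> (\<psi> x = 0 \<longleftrightarrow> x = 0\<^sub>v l)" if "x \<in> carrier_vec l" for x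
      using \<open>assoc_gauge l N \<psi>\<close> that unfolding assoc_gauge_def symmetric_gauge_def by blast
    ultimately show ?thesis using vec_carrier[of l "\<lambda>_. 1 :: real"] by (simp add: less_le)
  qed
  have eta: "real d * eta \<psi> l = real d / real l * \<psi> (vec l (\<lambda>_. 1))" for \<psi> by (simp add: eta_def)
  have p2: "real d * eta \<psi> l \<le> N ?q" if "assoc_gauge l N \<psi>" for N \<psi>
    using mult_right_mono[OF avg, of "\<psi> (vec l (\<lambda>_. 1))"] norm_ge[OF that] gauge_pos[OF that]
    unfolding eta by simp

  have fq: "Re (mat_trace (fun_calc f ?q)) = (\<Sum>i<l. f (a i))" for f
    by (rule trace_fun_calc_diagonalized[OF U q])
  have jensen: "real l * f (T / real l) \<le> Re (mat_trace (fun_calc f ?q))" if "convex_on {0..} f" for f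
    unfolding fq T_def using that a l by (intro convex_on_average) auto
  have p3: "real l * f (real d / real l) \<le> Re (mat_trace (fun_calc f ?q))"
    if "mono_on {0..} f" "convex_on {0..} f" for f
  proof -
    have "f (real d / real l) \<le> f (T / real l)"
      using avg dT by (intro mono_onD[OF that(1)]) auto
    then have "real l * f (real d / real l) \<le> real l * f (T / real l)"
      by (intro mult_left_mono) auto
    then show ?thesis using jensen[OF that(2)] by linarith
  qed

  have T_le: "T \<le> real d"
    if eq: "mat_majorized (complex_of_real (real d / real l) \<cdot>\<^sub>m 1\<^sub>m l) ?q
        \<or> (\<exists>N \<psi>. unitarily_invariant_norm l N \<and> assoc_gauge l N \<psi> \<and> real d * eta \<psi> l = N ?q)
        \<or> (\<exists>f. mono_on {0..} f \<and> strictly_convex_on {0..} f \<and> f 0 = 0 \<and>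
              real l * f (real d / real l) = Re (mat_trace (fun_calc f ?q)))"
    using eq
  proof (elim disjE exE conjE)
    assume "mat_majorized (complex_of_real (real d / real l) \<cdot>\<^sub>m 1\<^sub>m l) ?q"
    then show ?thesis using maj(2) by simp
  next
    fix N \<psi> assume g: "assoc_gauge l N \<psi>" and e: "real d * eta \<psi> l = N ?q"
    have "T / real l * \<psi> (vec l (\<lambda>_. 1)) \<le> real d / real l * \<psi> (vec l (\<lambda>_. 1))"
      using norm_ge[OF g] e unfolding eta by simp
    then have "T / real l \<le> real d / real l"
      using gauge_pos[OF g] by (simp only: mult_le_cancel_right_pos)
    then show ?thesis using l by (simp add: divide_le_cancel)
  next
    fix f assume f: "mono_on {0..} f" "strictly_convex_on {0..} f"
      and e: "real l * f (real d / real l) = Re (mat_trace (fun_calc f ?q))"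
    have "real l * f (T / real l) \<le> real l * f (real d / real l)"
      using jensen[OF strictly_convex_on_imp_convex_on[OF f(2)]] e by simp
    then have "f (T / real l) \<le> f (real d / real l)" using l by simp
    then have "\<not> real d / real l < T / real l"
      using mono_strictly_convex_imp_strict_mono[OF f, of "real d / real l" "T / real l"] by auto
    then show ?thesis using l by (simp add: divide_less_cancel)
  qed

  \<comment> \<open>The only possible common weight: V_i V_i^* = w I_l for all i gives tr S = m l w,
    which must be d.\<close>
  define w where "w = real d / (real l * real m)"
  have w: "0 < w" using l m d by (simp add: w_def)
  have forward: "uwp_protocol F m l d V \<and> full_rank_system m l d V" if "T \<le> real d"
  proof -
    have VV: "V i * mat_adjoint (V i) = complex_of_real w \<cdot>\<^sub>m 1\<^sub>m l" if "i \<in> {1..m}" for i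
      unfolding w_def by (rule bound(3)) (use that \<open>T \<le> real d\<close> in auto)
    have "frame_op m d V = 1\<^sub>m d" by (rule bound(2)) (use that in auto)
    have "projective_weights F m d V (\<lambda>_. w)"
      unfolding projective_weights_def
    proof (intro ballI conjI exI)
      fix i assume i: "i \<in> {1..m}"
      show "orth_projection F d (complex_of_real (1 / w) \<cdot>\<^sub>m (mat_adjoint (V i) * V i))"
        by (rule orth_projection_of_scaled_coisometry[OF F VF[OF i] VV[OF i] w])
      have "complex_of_real w * (complex_of_real (1 / w) * z) = z" for z
        using w by simp
      then show "mat_adjoint (V i) * V i =
          complex_of_real w \<cdot>\<^sub>m (complex_of_real (1 / w) \<cdot>\<^sub>m (mat_adjoint (V i) * V i))"
        by (intro eq_matI) (simp_all del: index_mult_mat(1) of_real_divide times_divide_eq_left times_divide_eq_right)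
    qed (rule w)
    with \<open>frame_op m d V = 1\<^sub>m d\<close> have "uwp_protocol F m l d V"
      using rs unfolding uwp_protocol_def protocol_def by blast
    moreover have "full_rank_system m l d V"
      unfolding full_rank_system_def
      using rank_adjoint_of_scaled_coisometry[OF V VV] w by simp
    ultimately show ?thesis ..
  qed
  \<comment> \<open>One disjunct suffices. For a protocol S = I, hence tr P_q(V) = tr I = d, which
    is the equality of traces that majorization adds to submajorization.\<close>
  have backward: "mat_majorized (complex_of_real (real d / real l) \<cdot>\<^sub>m 1\<^sub>m l) ?q"
    if "uwp_protocol F m l d V"
  proof -
    have "frame_op m d V = 1\<^sub>m d" using that by (simp add: uwp_protocol_def protocol_def)
    then have "T = real d"
      using trace_q_potential[where m = m and V = V, OF V] by (simp add: T[symmetric] mat_trace_def)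
    then show ?thesis using maj(2) by simp
  qed
  show ?thesis
  proof (intro conjI)
    show "mat_submajorized (complex_of_real (real d / real l) \<cdot>\<^sub>m 1\<^sub>m l) ?q" by (rule maj(1))
  qed (use p2 p3 T_le forward backward in blast)+
qed

end
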